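(* Let $N\ge2$ be an integer, let $\varphi\in L^2(\mathbb{R})$ be a scale-$2$ father function with associated functions $m_0$ and $m_1(z)=z\,\overline{m_0(-z)}$ on $\mathbb{T}$ and mother function $\psi$, and consider the orthogonal decomposition $$N^{-1/2}\varphi(x/N)=\sum_kA_k\varphi(x-k)+\sum_kB_k\psi(x-k)+\xi_-(x),$$ where $\xi_-\in\mathcal{V}_{-1}^\perp$ and $\sum_k(|A_k|^2+|B_k|^2)+\|\xi_-\|_2^2=1$. Define $A(t)=\sum_kA_ke^{-ikt}$ and $B(t)=\sum_kB_ke^{-ikt}$. Then $$A(2t)m_0(t)+B(2t)m_1(t)=A(t)m_0(Nt),$$ or, in terms of the representation $S_0,S_1$ of $\mathcal{O}_2$ defined by $\varphi$, namely $(S_i\xi)(z)=m_i(z)\xi(z^2)$ on $L^2(\mathbb{T})$, $$S_0(A)(z)+S_1(B)(z)=m_0(z^N)A(z).$$ In particular, the functions in the left sum are orthogonal, so $$\|A\|_{L^2(\mathbb{T})}^2+\|B\|_{L^2(\mathbb{T})}^2=\int_{\mathbb{T}}|m_0(z^N)A(z)|^2\frac{|dz|}{2\pi}=N^{-1}\int_{\mathbb{T}}|m_0(z)|^2\sum_{w:\,w^N=z}|A(w)|^2\frac{|dz|}{2\pi}.$$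
   Context: Functions on $\mathbb{T}$ (normalized Haar measure $|dz|/2\pi$) are viewed as $2\pi$-periodic functions of $t$ via $z=e^{-it}$; $\hat f(t)=\frac1{\sqrt{2\pi}}\int_{\mathbb{R}}e^{-ixt}f(x)\,dx$; $(U\xi)(x)=2^{-1/2}\xi(x/2)$ on $L^2(\mathbb{R})$. A scale-$2$ father function is $\varphi\in L^2(\mathbb{R})$ such that $\{\varphi(\cdot-k):k\in\mathbb{Z}\}$ is an orthonormal set; with $\mathcal{V}_0$ its closed linear span, $U\varphi\in\mathcal{V}_0$; and with $\mathcal{V}_n=U^n\mathcal{V}_0$, $\bigcap_n\mathcal{V}_n=\{0\}$ and $\overline{\bigcup_n\mathcal{V}_n}=L^2(\mathbb{R})$. $m_0=\sum_ka_ke^{-ikt}$ where $U\varphi=\sum_ka_k\varphi(\cdot-k)$, so $\sqrt2\hat\varphi(2t)=m_0(t)\hat\varphi(t)$. The mother function $\psi$ is defined by $\sqrt2\hat\psi(2t)=m_1(e^{-it})\hat\varphi(t)$; its translates $\psi(\cdot-k)$, $k\in\mathbb{Z}$, form an orthonormal basis of $\mathcal{V}_0^\perp\cap\mathcal{V}_{-1}$. *)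

theory Defs
  imports "HOL-Analysis.Analysis"
begin

section \<open>Square-integrable functions\<close>

text \<open>Elements of \<open>L\<^sup>2\<close> are represented by measurable functions; two representatives of
  the same element agree almost everywhere.\<close>

definition L2 :: "'a measure \<Rightarrow> ('a \<Rightarrow> complex) set" where
  "L2 M = {f \<in> borel_measurable M. integrable M (\<lambda>x. (cmod (f x))\<^sup>2)}"

definition L2_inner :: "'a measure \<Rightarrow> ('a \<Rightarrow> complex) \<Rightarrow> ('a \<Rightarrow> complex) \<Rightarrow> complex" where
  "L2_inner M f g = (LINT x|M. f x * cnj (g x))"

definition L2_norm :: "'a measure \<Rightarrow> ('a \<Rightarrow> complex) \<Rightarrow> real" where
  "L2_norm M f = sqrt (LINT x|M. (cmod (f x))\<^sup>2)"

text \<open>Membership in \<open>L2\<close> is part of convergence, because the Bochner integral in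
  \<open>L2_norm\<close> is 0 for functions that are not square-integrable.\<close>

definition L2_tendsto ::
    "'a measure \<Rightarrow> ('i \<Rightarrow> 'a \<Rightarrow> complex) \<Rightarrow> ('a \<Rightarrow> complex) \<Rightarrow> 'i filter \<Rightarrow> bool" where
  "L2_tendsto M u f F \<longleftrightarrow>
     f \<in> L2 M \<and> (\<forall>\<^sub>F i in F. u i \<in> L2 M) \<and>
     ((\<lambda>i. L2_norm M (\<lambda>x. u i x - f x)) \<longlongrightarrow> 0) F"

definition L2_has_sum ::
    "'a measure \<Rightarrow> ('k \<Rightarrow> 'a \<Rightarrow> complex) \<Rightarrow> ('a \<Rightarrow> complex) \<Rightarrow> bool" where
  "L2_has_sum M e f \<longleftrightarrow>
     L2_tendsto M (\<lambda>K x. \<Sum>k\<in>K. e k x) f (finite_subsets_at_top UNIV)"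

definition L2_closure :: "'a measure \<Rightarrow> ('a \<Rightarrow> complex) set \<Rightarrow> ('a \<Rightarrow> complex) set" where
  "L2_closure M S =
     {f \<in> L2 M. \<forall>\<epsilon>>0. \<exists>g\<in>S. g \<in> L2 M \<and> L2_norm M (\<lambda>x. f x - g x) < \<epsilon>}"

definition L2_orth :: "'a measure \<Rightarrow> ('a \<Rightarrow> complex) set \<Rightarrow> ('a \<Rightarrow> complex) set" where
  "L2_orth M S = {f \<in> L2 M. \<forall>g\<in>S. L2_inner M f g = 0}"

definition complex_span :: "('a \<Rightarrow> complex) set \<Rightarrow> ('a \<Rightarrow> complex) set" where
  "complex_span S = {(\<lambda>x. \<Sum>g\<in>G. c g * g x) | G c. finite G \<and> G \<subseteq> S}"


section \<open>Multiresolution analysis on the line\<close>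

definition translate :: "(real \<Rightarrow> complex) \<Rightarrow> int \<Rightarrow> real \<Rightarrow> complex" where
  "translate f k = (\<lambda>x. f (x - of_int k))"

definition U :: "(real \<Rightarrow> complex) \<Rightarrow> real \<Rightarrow> complex" where
  "U \<xi> = (\<lambda>x. complex_of_real (2 powr (-1/2)) * \<xi> (x / 2))"

text \<open>\<open>U\<close> is a bijection on all functions (not only modulo null sets), so \<open>inv U\<close> is its
  inverse.\<close>

definition U_pow :: "int \<Rightarrow> (real \<Rightarrow> complex) \<Rightarrow> real \<Rightarrow> complex" where
  "U_pow n = (if n \<ge> 0 then U ^^ nat n else inv U ^^ nat (- n))"

definition V :: "(real \<Rightarrow> complex) \<Rightarrow> int \<Rightarrow> (real \<Rightarrow> complex) set" where
  "V \<phi> n = U_pow n ` L2_closure lborel (complex_span (range (translate \<phi>)))"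

definition father_function :: "(real \<Rightarrow> complex) \<Rightarrow> bool" where
  "father_function \<phi> \<longleftrightarrow>
     \<phi> \<in> L2 lborel \<and>
     (\<forall>j k. L2_inner lborel (translate \<phi> j) (translate \<phi> k) = (if j = k then 1 else 0)) \<and>
     U \<phi> \<in> V \<phi> 0 \<and>
     (\<forall>f \<in> (\<Inter>n. V \<phi> n). AE x in lborel. f x = 0) \<and>
     L2_closure lborel (\<Union>n. V \<phi> n) = L2 lborel"

text \<open>The Fourier--Plancherel transform: \<open>f_hat\<close> is the \<open>L\<^sup>2\<close>-limit of the truncated Fourier
  integrals of \<open>f\<close>.  It is a relation because \<open>f_hat\<close> is only determined almost everywhere.\<close>

definition is_fourier :: "(real \<Rightarrow> complex) \<Rightarrow> (real \<Rightarrow> complex) \<Rightarrow> bool" where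
  "is_fourier f f_hat \<longleftrightarrow>
     f \<in> L2 lborel \<and>
     L2_tendsto lborel
       (\<lambda>R t. complex_of_real (1 / sqrt (2 * pi)) *
              (LINT x:{-R..R}|lborel. exp (- \<i> * of_real (x * t)) * f x))
       f_hat at_top"


section \<open>Functions on the circle\<close>

text \<open>Normalized Haar measure on the unit circle, as a Borel measure on the complex plane that
  is concentrated on the circle.\<close>

definition circle :: "complex measure" where
  "circle = distr (uniform_measure lborel {0..<2*pi}) borel (\<lambda>t. exp (- \<i> * of_real t))"

text \<open>A function on the circle viewed as a \<open>2\<pi>\<close>-periodic function of \<open>t\<close>.\<close>

definition periodic :: "(complex \<Rightarrow> complex) \<Rightarrow> real \<Rightarrow> complex" where
  "periodic f t = f (exp (- \<i> * of_real t))"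

text \<open>The series \<open>\<Sum> a\<^sub>k e\<^sup>-\<^sup>i\<^sup>k\<^sup>t\<close>, where \<open>e\<^sup>-\<^sup>i\<^sup>k\<^sup>t = z\<^sup>k\<close>
  because \<open>z = e\<^sup>-\<^sup>i\<^sup>t\<close>.\<close>

definition is_fourier_series :: "(int \<Rightarrow> complex) \<Rightarrow> (complex \<Rightarrow> complex) \<Rightarrow> bool" where
  "is_fourier_series a f \<longleftrightarrow> L2_has_sum circle (\<lambda>k z. a k * z powi k) f"

definition is_m0 :: "(real \<Rightarrow> complex) \<Rightarrow> (complex \<Rightarrow> complex) \<Rightarrow> bool" where
  "is_m0 \<phi> m0 \<longleftrightarrow>
     (\<exists>a. L2_has_sum lborel (\<lambda>k x. a k * translate \<phi> k x) (U \<phi>) \<and> is_fourier_series a m0)"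

definition is_mother_function ::
    "(real \<Rightarrow> complex) \<Rightarrow> (complex \<Rightarrow> complex) \<Rightarrow> (real \<Rightarrow> complex) \<Rightarrow> bool" where
  "is_mother_function \<phi> m1 \<psi> \<longleftrightarrow>
     (\<exists>\<phi>_hat \<psi>_hat. is_fourier \<phi> \<phi>_hat \<and> is_fourier \<psi> \<psi>_hat \<and>
        (AE t in lborel.
           complex_of_real (sqrt 2) * \<psi>_hat (2 * t) = periodic m1 t * \<phi>_hat t))"

definition S :: "(complex \<Rightarrow> complex) \<Rightarrow> (complex \<Rightarrow> complex) \<Rightarrow> complex \<Rightarrow> complex" where
  "S m \<xi> = (\<lambda>z. m z * \<xi> (z\<^sup>2))"

end

theory Submission
  imports Defs "HOL-Probability.Levy"
begin

text \<open>Apply \<open>U\<close> to the decomposition of \<open>N\<^sup>-\<^sup>1\<^sup>/\<^sup>2 \<phi>(x/N)\<close> and take inner products with the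
  translates of \<open>\<phi>\<close>. The part \<open>U \<xi>\<close> is orthogonal to them, the two series contribute the Fourier
  coefficients of \<open>A(z\<^sup>2) m\<^sub>0(z)\<close> and \<open>B(z\<^sup>2) m\<^sub>1(z)\<close>, and the left-hand side, expanded through
  \<open>U \<phi> = \<Sum> h\<^sub>k \<phi>(x - k)\<close>, contributes those of \<open>m\<^sub>0(z\<^sup>N) A(z)\<close>. All three products are in \<open>L\<^sup>1\<close>, where
  Fourier coefficients determine a function. Orthonormality of the translates of \<open>\<phi>\<close> yields
  \<open>|m\<^sub>0(z)|\<^sup>2 + |m\<^sub>0(-z)|\<^sup>2 = 2\<close>, hence the statements about norms; inner products of the two
  branches vanish because their integrands are odd under \<open>z \<mapsto> -z\<close>.

  The Fourier transform enters only through the definition of \<open>\<psi>\<close>, and Plancherel's theorem is not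
  needed: testing transforms against indicators of the intervals \<open>[\<tau>, \<tau> + 1]\<close> shows that
  \<open>U \<psi>\<close> is the series in translates of \<open>\<phi>\<close> with the coefficients of \<open>m\<^sub>1\<close>.\<close>

section \<open>Square-integrable functions\<close>

text \<open>One vector, \<open>U\<close> of the \<open>N\<close>-dilate of \<open>\<phi>\<close>, is
  expanded twice; since dilations commute it is also the \<open>N\<close>-dilate of
  \<open>U \<phi>\<close>. Dilating a series of translates by \<open>q\<close> turns the translate
  by \<open>k\<close> into the one by \<open>q * k\<close>, which puts \<open>z ^ q\<close> into its
  coefficient function and multiplies by the symbol of the dilated generator at \<open>z\<close>.
  The decomposition gives \<open>A\<close> and \<open>B\<close> at \<open>z ^ 2\<close>; the
  expansion of \<open>U \<phi>\<close> gives \<open>m0\<close> at \<open>z ^ N\<close>, with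
  \<open>A\<close> now in the role of a symbol. The vector itself need not lie in
  \<open>V \<phi> 0\<close>: what is compared is its projection, recorded by the inner products with
  the translates.

  Uniqueness is proved for integrable functions because it is first applied to a function built from
  \<open>|m0|^2\<close>, and boundedness of \<open>m0\<close> is only a consequence of that
  application. A second obstacle is that \<open>\<psi>\<close> is known only through its transform.
  The series that should equal \<open>U \<psi>\<close> must first be given a limit, hence the
  completeness of L2; and the periodic function \<open>m1\<close> is not square-integrable on the
  line, hence test functions whose transforms have bounded support.\<close>

lemma L2_measurable [measurable_dest]: "f \<in> L2 M \<Longrightarrow> f \<in> borel_measurable M"
  by (simp add: L2_def)

lemma L2_integrable_sq: "f \<in> L2 M \<Longrightarrow> integrable M (\<lambda>x. (cmod (f x))\<^sup>2)"
  by (simp add: L2_def)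

lemma L2_cmult: "f \<in> L2 M \<Longrightarrow> (\<lambda>x. c * f x) \<in> L2 M"
  by (auto simp: L2_def norm_mult power_mult_distrib)

lemma borel_measurable_cnj [measurable (raw)]:
  "f \<in> borel_measurable M \<Longrightarrow> (\<lambda>x. cnj (f x)) \<in> borel_measurable M"
  by (rule measurable_compose[OF _ borel_measurable_continuous_onI]) (auto intro: continuous_intros)

lemma L2_cnj: "f \<in> L2 M \<Longrightarrow> (\<lambda>x. cnj (f x)) \<in> L2 M"
  unfolding L2_def by auto

lemma L2_mult_bound: "cmod (a * b) \<le> (cmod a)\<^sup>2 + (cmod b)\<^sup>2"
  using sum_squares_bound[of "cmod a" "cmod b"] mult_nonneg_nonneg[of "cmod a" "cmod b"]
  unfolding norm_mult mult.assoc by (smt (verit) norm_ge_zero)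

lemma L2_mult_integrable:
  assumes "f \<in> L2 M" "g \<in> L2 M"
  shows "integrable M (\<lambda>x. f x * g x)"
proof (rule Bochner_Integration.integrable_bound)
  show "integrable M (\<lambda>x. (cmod (f x))\<^sup>2 + (cmod (g x))\<^sup>2)"
    using assms by (auto intro!: L2_integrable_sq)
  show "(\<lambda>x. f x * g x) \<in> borel_measurable M"
    using assms by (auto intro: L2_measurable)
  show "AE x in M. norm (f x * g x) \<le> norm ((cmod (f x))\<^sup>2 + (cmod (g x))\<^sup>2)"
    using L2_mult_bound by (auto simp: )
qed

lemma L2_inner_integrable:
  "f \<in> L2 M \<Longrightarrow> g \<in> L2 M \<Longrightarrow> integrable M (\<lambda>x. f x * cnj (g x))"
  by (intro L2_mult_integrable L2_cnj)

lemma L2_add: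
  assumes "f \<in> L2 M" "g \<in> L2 M"
  shows "(\<lambda>x. f x + g x) \<in> L2 M"
proof -
  have "integrable M (\<lambda>x. (cmod (f x + g x))\<^sup>2)"
  proof (rule Bochner_Integration.integrable_bound)
    show "integrable M (\<lambda>x. 2 * ((cmod (f x))\<^sup>2 + (cmod (g x))\<^sup>2))"
      using assms by (auto intro!: L2_integrable_sq)
    show "(\<lambda>x. (cmod (f x + g x))\<^sup>2) \<in> borel_measurable M"
      using assms[THEN L2_measurable] by measurable
    have "(cmod (a + b))\<^sup>2 \<le> 2 * ((cmod a)\<^sup>2 + (cmod b)\<^sup>2)" for a b
    proof -
      have "(cmod (a + b))\<^sup>2 \<le> (cmod a + cmod b)\<^sup>2"
        by (intro power_mono norm_triangle_ineq) auto
      also have "\<dots> \<le> 2 * ((cmod a)\<^sup>2 + (cmod b)\<^sup>2)"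
        using sum_squares_bound[of "cmod a" "cmod b"] by (simp add: power2_sum)
      finally show ?thesis .
    qed
    then show "AE x in M. norm ((cmod (f x + g x))\<^sup>2)
        \<le> norm (2 * ((cmod (f x))\<^sup>2 + (cmod (g x))\<^sup>2))" by auto
  qed
  with assms show ?thesis by (auto simp: L2_def)
qed

lemma L2_diff: "f \<in> L2 M \<Longrightarrow> g \<in> L2 M \<Longrightarrow> (\<lambda>x. f x - g x) \<in> L2 M"
  using L2_add[of f M "\<lambda>x. - 1 * g x"] L2_cmult[of g M "-1"] by simp

lemma L2_zero: "(\<lambda>x. 0) \<in> L2 M"
  by (simp add: L2_def)

lemma L2_sum: "(\<And>k. k \<in> K \<Longrightarrow> e k \<in> L2 M) \<Longrightarrow> (\<lambda>x. \<Sum>k\<in>K. e k x) \<in> L2 M"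
  by (induction K rule: infinite_finite_induct) (auto intro: L2_zero L2_add)

lemma L2_AE_cong:
  assumes "f \<in> L2 M" "g \<in> borel_measurable M" "AE x in M. f x = g x"
  shows "g \<in> L2 M"
proof -
  have "integrable M (\<lambda>x. (cmod (g x))\<^sup>2) \<longleftrightarrow> integrable M (\<lambda>x. (cmod (f x))\<^sup>2)"
    using assms L2_measurable[OF assms(1)] by (intro integrable_cong_AE) (auto elim: eventually_mono)
  with assms show ?thesis by (simp add: L2_def)
qed

lemma L2_norm_nonneg [simp]: "L2_norm M f \<ge> 0"
  by (simp add: L2_norm_def)

lemma L2_norm_sq: "(L2_norm M f)\<^sup>2 = (LINT x|M. (cmod (f x))\<^sup>2)"
  by (simp add: L2_norm_def)

lemma L2_norm_inner: "complex_of_real ((L2_norm M f)\<^sup>2) = L2_inner M f f"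
  unfolding L2_norm_sq L2_inner_def
  by (simp add: complex_norm_square[symmetric] flip: integral_complex_of_real)

lemma L2_inner_cnj: "cnj (L2_inner M f g) = L2_inner M g f"
  unfolding L2_inner_def by (subst Bochner_Integration.integral_cnj[symmetric]) (simp add: mult.commute)

text \<open>Reduced to the inequality for nonnegative extended integrals; the squares avoid square
  roots of \<open>ennreal\<close> values.\<close>

lemma L2_Cauchy_Schwarz_abs:
  assumes f: "f \<in> L2 M" and g: "g \<in> L2 M"
  shows "(LINT x|M. cmod (f x) * cmod (g x)) \<le> L2_norm M f * L2_norm M g"
proof -
  note [measurable] = f[THEN L2_measurable] g[THEN L2_measurable]
  have int: "integrable M (\<lambda>x. cmod (f x) * cmod (g x))"
    using integrable_norm[OF L2_mult_integrable[OF f g]] by (simp add: norm_mult)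
  have "ennreal ((LINT x|M. cmod (f x) * cmod (g x))\<^sup>2)
      = (\<integral>\<^sup>+x. ennreal (cmod (f x)) * ennreal (cmod (g x)) \<partial>M)\<^sup>2"
    using int by (subst ennreal_power[symmetric])
      (auto simp: nn_integral_eq_integral[symmetric] ennreal_mult intro!: Bochner_Integration.integral_nonneg)
  also have "\<dots> \<le> (\<integral>\<^sup>+x. (ennreal (cmod (f x)))\<^sup>2 \<partial>M) * (\<integral>\<^sup>+x. (ennreal (cmod (g x)))\<^sup>2 \<partial>M)"
    by (intro Cauchy_Schwarz_nn_integral) auto
  also have "\<dots> = ennreal ((LINT x|M. (cmod (f x))\<^sup>2) * (LINT x|M. (cmod (g x))\<^sup>2))"
    using f g by (simp add: ennreal_power nn_integral_eq_integral L2_integrable_sq ennreal_mult)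
  finally have "(LINT x|M. cmod (f x) * cmod (g x))\<^sup>2 \<le> (L2_norm M f * L2_norm M g)\<^sup>2"
    unfolding power_mult_distrib L2_norm_sq by (subst (asm) ennreal_le_iff) auto
  then show ?thesis by (rule power2_le_imp_le) simp
qed

lemma L2_Cauchy_Schwarz:
  assumes f: "f \<in> L2 M" and g: "g \<in> L2 M"
  shows "cmod (L2_inner M f g) \<le> L2_norm M f * L2_norm M g"
proof -
  have "cmod (L2_inner M f g) \<le> (LINT x|M. cmod (f x * cnj (g x)))"
    unfolding L2_inner_def by (rule integral_norm_bound)
  also have "\<dots> \<le> L2_norm M f * L2_norm M g"
    using L2_Cauchy_Schwarz_abs[OF f g] by (simp add: norm_mult)
  finally show ?thesis .
qed

lemma L2_inner_add_left:
  "f \<in> L2 M \<Longrightarrow> g \<in> L2 M \<Longrightarrow> h \<in> L2 M \<Longrightarrow>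
    L2_inner M (\<lambda>x. f x + g x) h = L2_inner M f h + L2_inner M g h"
  unfolding L2_inner_def by (simp add: distrib_right L2_inner_integrable)

lemma L2_inner_diff_left:
  "f \<in> L2 M \<Longrightarrow> g \<in> L2 M \<Longrightarrow> h \<in> L2 M \<Longrightarrow>
    L2_inner M (\<lambda>x. f x - g x) h = L2_inner M f h - L2_inner M g h"
  unfolding L2_inner_def by (simp add: left_diff_distrib L2_inner_integrable)

lemma L2_inner_cmult_left: "L2_inner M (\<lambda>x. c * f x) h = c * L2_inner M f h"
  unfolding L2_inner_def by (simp add: mult.assoc)

lemma L2_inner_sum_left:
  "(\<And>k. k \<in> K \<Longrightarrow> e k \<in> L2 M) \<Longrightarrow> h \<in> L2 M \<Longrightarrow>
    L2_inner M (\<lambda>x. \<Sum>k\<in>K. e k x) h = (\<Sum>k\<in>K. L2_inner M (e k) h)"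
  unfolding L2_inner_def
  by (subst Bochner_Integration.integral_sum[symmetric])
     (auto simp: sum_distrib_right intro: L2_inner_integrable)

lemma L2_inner_AE_cong:
  assumes "f \<in> borel_measurable M" "g \<in> borel_measurable M" "h \<in> borel_measurable M"
    and "AE x in M. f x = g x"
  shows "L2_inner M f h = L2_inner M g h" "L2_inner M h f = L2_inner M h g"
  using assms(4) unfolding L2_inner_def
  by (intro integral_cong_AE borel_measurable_times borel_measurable_cnj assms(1-3); elim eventually_mono; simp)+

lemma L2_tendsto_inner:
  assumes "L2_tendsto M u f F" "g \<in> L2 M"
  shows "((\<lambda>i. L2_inner M (u i) g) \<longlongrightarrow> L2_inner M f g) F"
proof (rule Lim_null_comparison[THEN LIM_zero_cancel])
  from assms have f: "f \<in> L2 M" and u: "\<forall>\<^sub>F i in F. u i \<in> L2 M"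
    and lim: "((\<lambda>i. L2_norm M (\<lambda>x. u i x - f x)) \<longlongrightarrow> 0) F" by (auto simp: L2_tendsto_def)
  show "\<forall>\<^sub>F i in F. norm (L2_inner M (u i) g - L2_inner M f g)
      \<le> L2_norm M (\<lambda>x. u i x - f x) * L2_norm M g"
    using u
  proof eventually_elim
    case (elim i)
    have "L2_inner M (u i) g - L2_inner M f g = L2_inner M (\<lambda>x. u i x - f x) g"
      using elim f assms(2) by (simp add: L2_inner_diff_left)
    then show ?case using L2_Cauchy_Schwarz[OF L2_diff[OF elim f] assms(2)] by simp
  qed
  show "((\<lambda>i. L2_norm M (\<lambda>x. u i x - f x) * L2_norm M g) \<longlongrightarrow> 0) F"
    using tendsto_mult_left_zero[OF lim] by simp
qed

lemma L2_has_sum_limit: "L2_has_sum M e f \<Longrightarrow> f \<in> L2 M"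
  by (simp add: L2_has_sum_def L2_tendsto_def)

lemma L2_has_sum_inner:
  assumes "L2_has_sum M e f" "\<And>k. e k \<in> L2 M" "g \<in> L2 M"
  shows "((\<lambda>k. L2_inner M (e k) g) has_sum L2_inner M f g) UNIV"
  using L2_tendsto_inner[OF assms(1)[unfolded L2_has_sum_def] assms(3)] assms(2,3)
  by (simp add: has_sum_def L2_inner_sum_left)

text \<open>Only differences are assumed to be respected, so that conjugate-linear maps are covered
  too, in particular the map \<open>f \<mapsto> z * cnj (f (- z))\<close> that carries
  \<open>m0\<close> to \<open>m1\<close>.\<close>

lemma L2_tendsto_isometry:
  assumes diff: "\<And>f g. T (\<lambda>x. f x - g x) = (\<lambda>x. T f x - T g x)"
    and iso: "\<And>f. f \<in> L2 M \<Longrightarrow> T f \<in> L2 M' \<and> L2_norm M' (T f) = L2_norm M f"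
    and lim: "L2_tendsto M u f F"
  shows "L2_tendsto M' (\<lambda>i. T (u i)) (T f) F"
proof -
  from lim have f: "f \<in> L2 M" and u: "\<forall>\<^sub>F i in F. u i \<in> L2 M"
    and l: "((\<lambda>i. L2_norm M (\<lambda>x. u i x - f x)) \<longlongrightarrow> 0) F" by (auto simp: L2_tendsto_def)
  have "\<forall>\<^sub>F i in F. L2_norm M (\<lambda>x. u i x - f x) = L2_norm M' (\<lambda>x. T (u i) x - T f x)"
    using u iso f L2_diff by (elim eventually_mono) (simp add: diff[symmetric] L2_diff)
  with l have "((\<lambda>i. L2_norm M' (\<lambda>x. T (u i) x - T f x)) \<longlongrightarrow> 0) F"
    by (rule Lim_transform_eventually)
  with f u iso show ?thesis by (auto simp: L2_tendsto_def elim: eventually_mono)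
qed

lemma L2_has_sum_isometry:
  assumes diff: "\<And>f g. T (\<lambda>x. f x - g x) = (\<lambda>x. T f x - T g x)"
    and iso: "\<And>f. f \<in> L2 M \<Longrightarrow> T f \<in> L2 M' \<and> L2_norm M' (T f) = L2_norm M f"
    and sum: "L2_has_sum M e f"
  shows "L2_has_sum M' (\<lambda>k. T (e k)) (T f)"
proof -
  have zero: "T (\<lambda>x. 0) = (\<lambda>x. 0)"
    using diff[of "\<lambda>x. 0" "\<lambda>x. 0"] by simp
  have neg: "T (\<lambda>x. - f x) = (\<lambda>x. - T f x)" for f
    using diff[of "\<lambda>x. 0" f] by (simp add: zero)
  have add: "T (\<lambda>x. f x + g x) = (\<lambda>x. T f x + T g x)" for f g
    using diff[of f "\<lambda>x. - g x"] by (simp add: neg)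
  have "T (\<lambda>x. \<Sum>k\<in>K. e k x) = (\<lambda>x. \<Sum>k\<in>K. T (e k) x)" for K
    by (induction K rule: infinite_finite_induct) (simp_all add: zero add)
  then show ?thesis
    using L2_tendsto_isometry[of T, OF diff iso sum[unfolded L2_has_sum_def]]
    by (simp add: L2_has_sum_def)
qed

lemma L2_norm_eqI:
  "f \<in> L2 M \<Longrightarrow> L2_inner M f f = L2_inner M' g g \<Longrightarrow> L2_norm M f = L2_norm M' g"
  using L2_norm_inner[of M f] L2_norm_inner[of M' g]
  by (metis L2_norm_nonneg of_real_eq_iff power2_eq_imp_eq)

text \<open>Replaces unconditional summation over the integers by an ordinary sequence of partial
  sums, so that completeness and uniqueness of sequential limits can be applied.\<close>

lemma filterlim_symmetric_intervals:
  "filterlim (\<lambda>n. {- int n..int n}) (finite_subsets_at_top UNIV) sequentially"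
  unfolding filterlim_def le_filter_def eventually_filtermap
proof (intro allI impI)
  fix P assume "eventually P (finite_subsets_at_top (UNIV::int set))"
  then obtain X where X: "finite X" "\<And>Y. finite Y \<Longrightarrow> X \<subseteq> Y \<Longrightarrow> P Y"
    by (auto simp: eventually_finite_subsets_at_top)
  obtain B where B: "\<And>x. x \<in> X \<Longrightarrow> nat \<bar>x\<bar> \<le> B"
    using X(1) finite_nat_set_iff_bounded_le[of "(\<lambda>x. nat \<bar>x\<bar>) ` X"] by auto
  show "eventually (\<lambda>n. P {- int n..int n}) sequentially"
    unfolding eventually_sequentially
  proof (intro exI allI impI X(2))
    fix n assume "B \<le> n"
    then show "X \<subseteq> {- int n..int n}" using B by fastforce
  qed auto
qed

lemma L2_has_sum_sequentially:
  fixes e :: "int \<Rightarrow> 'a \<Rightarrow> complex"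
  assumes "L2_has_sum M e f"
  shows "L2_tendsto M (\<lambda>n x. \<Sum>k\<in>{- int n..int n}. e k x) f sequentially"
  using assms filterlim_symmetric_intervals
  unfolding L2_has_sum_def L2_tendsto_def
  by (auto simp: filterlim_iff intro: filterlim_compose)

lemma L2_norm_Pythagoras:
  assumes "f \<in> L2 M" "g \<in> L2 M" "L2_inner M f g = 0"
  shows "(L2_norm M (\<lambda>x. f x + g x))\<^sup>2 = (L2_norm M f)\<^sup>2 + (L2_norm M g)\<^sup>2"
proof -
  have fg: "(\<lambda>x. f x + g x) \<in> L2 M" using assms by (intro L2_add)
  have sym: "L2_inner M g f = 0" using assms(3) L2_inner_cnj[of M f g] by simp
  have "L2_inner M f (\<lambda>x. f x + g x) = L2_inner M f f" "L2_inner M g (\<lambda>x. f x + g x) = L2_inner M g g"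
    using L2_inner_cnj[of M "\<lambda>x. f x + g x" f] L2_inner_cnj[of M "\<lambda>x. f x + g x" g] assms sym
    by (simp_all add: L2_inner_add_left L2_inner_cnj)
  then have "L2_inner M (\<lambda>x. f x + g x) (\<lambda>x. f x + g x) = L2_inner M f f + L2_inner M g g"
    using assms fg by (simp add: L2_inner_add_left)
  then show ?thesis
    unfolding L2_norm_inner[symmetric] by (simp only: of_real_add[symmetric] of_real_eq_iff)
qed

lemma orthonormal_coefficient:
  assumes sum: "L2_has_sum M (\<lambda>k x. c k * e k x) f" and e: "\<And>k. e k \<in> L2 M"
    and on: "\<And>j k. L2_inner M (e j) (e k) = (if j = k then 1 else 0)"
  shows "L2_inner M f (e j) = c j"
proof -
  have "((\<lambda>k. L2_inner M (\<lambda>x. c k * e k x) (e j)) has_sum L2_inner M f (e j)) UNIV"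
    by (intro L2_has_sum_inner sum L2_cmult e)
  moreover have "((\<lambda>k. L2_inner M (\<lambda>x. c k * e k x) (e j)) has_sum c j) UNIV"
    by (rule has_sum_finite_neutralI[of "{j}"]) (auto simp: L2_inner_cmult_left on)
  ultimately show ?thesis by (rule has_sum_unique)
qed

text \<open>For rewriting the terms of a series by identities such as \<open>cnj z = 1 / z\<close>,
  which hold on the unit circle only.\<close>

lemma L2_tendsto_AE_cong:
  assumes lim: "L2_tendsto M u f F" and meas: "\<And>i. u' i \<in> borel_measurable M"
    and eq: "\<And>i. AE x in M. u i x = u' i x"
  shows "L2_tendsto M u' f F"
proof -
  from lim have f: "f \<in> L2 M" and u: "\<forall>\<^sub>F i in F. u i \<in> L2 M"
    and l: "((\<lambda>i. L2_norm M (\<lambda>x. u i x - f x)) \<longlongrightarrow> 0) F" by (auto simp: L2_tendsto_def)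
  have u': "\<forall>\<^sub>F i in F. u' i \<in> L2 M"
    using u by eventually_elim (rule L2_AE_cong[OF _ meas eq])
  have "\<forall>\<^sub>F i in F. L2_norm M (\<lambda>x. u i x - f x) = L2_norm M (\<lambda>x. u' i x - f x)"
    using u
  proof eventually_elim
    case (elim i)
    have [measurable]: "f \<in> borel_measurable M" "u i \<in> borel_measurable M" "u' i \<in> borel_measurable M"
      using L2_measurable[OF f] L2_measurable[OF elim] meas by auto
    show ?case unfolding L2_norm_def
      by (intro arg_cong[of _ _ sqrt] integral_cong_AE) (use eq[of i] in \<open>auto elim: eventually_mono\<close>)
  qed
  with l have "((\<lambda>i. L2_norm M (\<lambda>x. u' i x - f x)) \<longlongrightarrow> 0) F"
    by (rule Lim_transform_eventually)
  with f u' show ?thesis by (simp add: L2_tendsto_def)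
qed

section \<open>Completeness\<close>

text \<open>The core of the Riesz-Fischer theorem. The rate \<open>(1/4) ^ n\<close> for squared
  norms is chosen so that the weight \<open>2 ^ n\<close> still leaves a convergent geometric
  series.\<close>

lemma L2_rapidly_Cauchy_converges:
  fixes f :: "nat \<Rightarrow> 'a \<Rightarrow> complex"
  assumes f: "\<And>n. f n \<in> L2 M"
    and fast: "\<And>m n. n \<le> m \<Longrightarrow> (L2_norm M (\<lambda>x. f m x - f n x))\<^sup>2 \<le> (1/4) ^ n"
  obtains g where "g \<in> L2 M" "\<And>n. (L2_norm M (\<lambda>x. g x - f n x))\<^sup>2 \<le> (1/4) ^ n"
proof -
  note [measurable] = f[THEN L2_measurable]
  have nn: "(\<integral>\<^sup>+x. ennreal ((cmod (f m x - f n x))\<^sup>2) \<partial>M) \<le> ennreal ((1/4) ^ n)" if "n \<le> m" for m n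
    using fast[OF that] unfolding L2_norm_sq
    by (subst nn_integral_eq_integral) (auto intro!: L2_integrable_sq L2_diff f)
  txt \<open>Weighting the squared increments by \<open>2 ^ n\<close> makes their sum integrable and still
    dominates the increments, since \<open>w \<le> 2\<^sup>-\<^sup>n + 2 ^ n w\<^sup>2\<close>.\<close>
  have "(\<integral>\<^sup>+x. (\<Sum>n. ennreal (2 ^ n * (cmod (f (Suc n) x - f n x))\<^sup>2)) \<partial>M)
      = (\<Sum>n. \<integral>\<^sup>+x. ennreal (2 ^ n * (cmod (f (Suc n) x - f n x))\<^sup>2) \<partial>M)"
    by (rule nn_integral_suminf) measurable
  also have "\<dots> \<le> (\<Sum>n. ennreal ((1/2) ^ n))"
  proof (intro suminf_le summableI)
    fix n
    have "(\<integral>\<^sup>+x. ennreal (2 ^ n * (cmod (f (Suc n) x - f n x))\<^sup>2) \<partial>M)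
        = ennreal (2 ^ n) * (\<integral>\<^sup>+x. ennreal ((cmod (f (Suc n) x - f n x))\<^sup>2) \<partial>M)"
      by (simp add: ennreal_mult nn_integral_cmult)
    also have "\<dots> \<le> ennreal (2 ^ n) * ennreal ((1/4) ^ n)"
      by (intro mult_left_mono nn) auto
    also have "\<dots> = ennreal ((1/2) ^ n)"
      by (simp add: ennreal_mult[symmetric] power_mult_distrib[symmetric])
    finally show "(\<integral>\<^sup>+x. ennreal (2 ^ n * (cmod (f (Suc n) x - f n x))\<^sup>2) \<partial>M) \<le> ennreal ((1/2) ^ n)" .
  qed
  also have "\<dots> < \<infinity>"
    by (subst suminf_ennreal2) (auto intro: summable_geometric)
  finally have "AE x in M. (\<Sum>n. ennreal (2 ^ n * (cmod (f (Suc n) x - f n x))\<^sup>2)) \<noteq> \<infinity>"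
    by (intro nn_integral_PInf_AE) auto
  then have conv: "AE x in M. convergent (\<lambda>n. f n x)"
  proof eventually_elim
    case (elim x)
    let ?w = "\<lambda>n. cmod (f (Suc n) x - f n x)"
    have sum: "summable (\<lambda>n. 2 ^ n * (?w n)\<^sup>2)"
      using elim by (intro summable_suminf_not_top) auto
    have "summable (\<lambda>n. f (Suc n) x - f n x)"
    proof (rule summable_comparison_test')
      show "summable (\<lambda>n. (1/2) ^ n + 2 ^ n * (?w n)\<^sup>2)"
        by (intro summable_add sum) (auto intro: summable_geometric)
      fix n :: nat
      have "0 \<le> (2 ^ n) * (?w n - (1/2) ^ n)\<^sup>2" by simp
      also have "\<dots> = 2 ^ n * (?w n)\<^sup>2 - 2 * ?w n + (1/2) ^ n"
        by (simp add: power2_diff power2_eq_square field_simps)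
      finally show "?w n \<le> (1/2) ^ n + 2 ^ n * (?w n)\<^sup>2"
        using norm_ge_zero[of "f (Suc n) x - f n x"] zero_le_power[of "1/2::real" n]
        by (smt (verit) divide_nonneg_nonneg zero_le_mult_iff zero_le_power2 zero_le_power)
    qed
    then have "(\<lambda>n. f n x - f 0 x) \<longlonglongrightarrow> (\<Sum>n. f (Suc n) x - f n x)"
      by (metis (no_types, lifting) ext summable_LIMSEQ sum_lessThan_telescope[of "\<lambda>n. f n x"])
    from tendsto_add[OF this tendsto_const[of "f 0 x"]] show ?case
      by (auto simp: convergent_def)
  qed
  \<comment> \<open>Where the sequence diverges, \<open>lim\<close> has an unspecified value; by
    \<open>conv\<close> this concerns a null set only.\<close>
  define g where "g = (\<lambda>x. lim (\<lambda>n. f n x))"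
  have [measurable]: "g \<in> borel_measurable M" unfolding g_def by measurable
  have lim: "AE x in M. (\<lambda>m. f m x) \<longlonglongrightarrow> g x"
    using conv by eventually_elim (simp add: g_def convergent_LIMSEQ_iff)
  \<comment> \<open>Fatou's lemma, with \<open>n\<close> fixed and \<open>m\<close> growing, carries
    the bound on the differences over to the pointwise limit.\<close>
  have bound: "(\<integral>\<^sup>+x. ennreal ((cmod (g x - f n x))\<^sup>2) \<partial>M) \<le> ennreal ((1/4) ^ n)" for n
  proof -
    have "AE x in M. ennreal ((cmod (g x - f n x))\<^sup>2)
        = liminf (\<lambda>m. ennreal ((cmod (f m x - f n x))\<^sup>2))"
      using lim
    proof eventually_elim
      case (elim x)
      have "(\<lambda>m. ennreal ((cmod (f m x - f n x))\<^sup>2)) \<longlonglongrightarrow> ennreal ((cmod (g x - f n x))\<^sup>2)"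
        by (intro tendsto_intros elim)
      then show ?case by (rule lim_imp_Liminf[OF sequentially_bot, symmetric])
    qed
    then have "(\<integral>\<^sup>+x. ennreal ((cmod (g x - f n x))\<^sup>2) \<partial>M)
        = (\<integral>\<^sup>+x. liminf (\<lambda>m. ennreal ((cmod (f m x - f n x))\<^sup>2)) \<partial>M)"
      by (rule nn_integral_cong_AE)
    also have "\<dots> \<le> liminf (\<lambda>m. \<integral>\<^sup>+x. ennreal ((cmod (f m x - f n x))\<^sup>2) \<partial>M)"
      by (intro nn_integral_liminf) measurable
    also have "\<dots> \<le> ennreal ((1/4) ^ n)"
    proof -
      have "liminf (\<lambda>m. \<integral>\<^sup>+x. ennreal ((cmod (f m x - f n x))\<^sup>2) \<partial>M) \<le> liminf (\<lambda>m. ennreal ((1/4) ^ n))"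
        by (intro Liminf_mono eventually_sequentiallyI[of n] nn)
      then show ?thesis by (simp add: Liminf_const)
    qed
    finally show ?thesis .
  qed
  have diff: "(\<lambda>x. g x - f n x) \<in> L2 M" for n
    using bound[of n] by (auto simp: L2_def integrable_iff_bounded intro: le_less_trans)
  show ?thesis
  proof
    show "g \<in> L2 M" using L2_add[OF diff[of 0] f[of 0]] by simp
    show "(L2_norm M (\<lambda>x. g x - f n x))\<^sup>2 \<le> (1/4) ^ n" for n
      using bound[of n] L2_integrable_sq[OF diff[of n]] unfolding L2_norm_sq
      by (subst (asm) nn_integral_eq_integral) auto
  qed
qed

lemma L2_norm_triangle:
  assumes "f \<in> L2 M" "g \<in> L2 M"
  shows "L2_norm M (\<lambda>x. f x + g x) \<le> L2_norm M f + L2_norm M g"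
proof (rule power2_le_imp_le)
  have fg: "(\<lambda>x. f x + g x) \<in> L2 M" using assms by (rule L2_add)
  have "L2_inner M (\<lambda>x. f x + g x) (\<lambda>x. f x + g x)
      = L2_inner M f f + L2_inner M g f + (cnj (L2_inner M g f) + L2_inner M g g)"
    using assms fg by (simp add: L2_inner_add_left L2_inner_cnj)
      (simp add: L2_inner_cnj[symmetric, of M _ "\<lambda>x. f x + g x"] L2_inner_add_left L2_inner_cnj)
  then have "(L2_norm M (\<lambda>x. f x + g x))\<^sup>2
      = (L2_norm M f)\<^sup>2 + (L2_norm M g)\<^sup>2 + 2 * Re (L2_inner M g f)"
    unfolding L2_norm_inner[symmetric] by (auto simp: complex_eq_iff)
  also have "\<dots> \<le> (L2_norm M f)\<^sup>2 + (L2_norm M g)\<^sup>2 + 2 * (L2_norm M g * L2_norm M f)"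
    using L2_Cauchy_Schwarz[OF assms(2,1)] complex_Re_le_cmod[of "L2_inner M g f"] by simp
  finally show "(L2_norm M (\<lambda>x. f x + g x))\<^sup>2 \<le> (L2_norm M f + L2_norm M g)\<^sup>2"
    by (simp add: power2_sum algebra_simps)
qed simp

lemma L2_norm_diff_commute: "L2_norm M (\<lambda>x. f x - g x) = L2_norm M (\<lambda>x. g x - f x)"
  unfolding L2_norm_def by (simp add: norm_minus_commute)

lemma L2_complete:
  fixes f :: "nat \<Rightarrow> 'a \<Rightarrow> complex"
  assumes f: "\<And>n. f n \<in> L2 M"
    and Cauchy: "\<And>\<epsilon>. \<epsilon> > 0 \<Longrightarrow> \<exists>n0. \<forall>n\<ge>n0. \<forall>m\<ge>n. L2_norm M (\<lambda>x. f m x - f n x) \<le> \<epsilon>"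
  obtains g where "L2_tendsto M f g sequentially"
proof -
  have "\<exists>n0. \<forall>n\<ge>n0. \<forall>m\<ge>n. L2_norm M (\<lambda>x. f m x - f n x) \<le> (1/2) ^ j" for j
    by (rule Cauchy) simp
  then obtain r where r: "\<And>j n m. r j \<le> n \<Longrightarrow> n \<le> m \<Longrightarrow> L2_norm M (\<lambda>x. f m x - f n x) \<le> (1/2) ^ j"
    by metis
  have quarter: "((1/2) ^ j)\<^sup>2 = (1/4 :: real) ^ j" for j
    unfolding power2_eq_square power_mult_distrib[symmetric] by simp
  \<comment> \<open>The thresholds \<open>r j\<close> need not increase with \<open>j\<close>; their
    partial sums do, and still dominate them, so they index a subsequence.\<close>
  define s where "s j = (\<Sum>i\<le>j. r i)" for j
  have s: "r j \<le> s j" "i \<le> j \<Longrightarrow> s i \<le> s j" for i j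
    unfolding s_def by (auto intro: member_le_sum sum_mono2)
  obtain g where g: "g \<in> L2 M" and *: "\<And>j. (L2_norm M (\<lambda>x. g x - f (s j) x))\<^sup>2 \<le> (1/4) ^ j"
  proof (rule L2_rapidly_Cauchy_converges[of "\<lambda>j. f (s j)" M])
    show "(L2_norm M (\<lambda>x. f (s i) x - f (s j) x))\<^sup>2 \<le> (1/4) ^ j" if "j \<le> i" for i j
      using power_mono[OF r[OF s(1) s(2)[OF that]] L2_norm_nonneg, of 2] unfolding quarter .
  qed (use f in auto)
  have near: "L2_norm M (\<lambda>x. f n x - g x) \<le> (1/2) ^ j + (1/2) ^ j" if "s j \<le> n" for n j
  proof -
    have "L2_norm M (\<lambda>x. f n x - g x) = L2_norm M (\<lambda>x. (f n x - f (s j) x) + (f (s j) x - g x))"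
      by simp
    also have "\<dots> \<le> L2_norm M (\<lambda>x. f n x - f (s j) x) + L2_norm M (\<lambda>x. f (s j) x - g x)"
      by (intro L2_norm_triangle L2_diff f g)
    also have "L2_norm M (\<lambda>x. f (s j) x - g x) \<le> (1/2) ^ j"
      using *[of j] unfolding L2_norm_diff_commute[of M g] quarter[symmetric]
      by (rule power2_le_imp_le) simp
    finally show ?thesis using r[OF s(1) that] by simp
  qed
  have "(\<lambda>n. L2_norm M (\<lambda>x. f n x - g x)) \<longlonglongrightarrow> 0"
  proof (rule LIMSEQ_I)
    fix \<epsilon> :: real assume "\<epsilon> > 0"
    then obtain j where "(1/2) ^ j < \<epsilon> / 2"
      using real_arch_pow_inv[of "\<epsilon> / 2" "1/2"] by auto
    then show "\<exists>n0. \<forall>n\<ge>n0. norm (L2_norm M (\<lambda>x. f n x - g x) - 0) < \<epsilon>"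
      using near[of j] by (intro exI[of _ "s j"]) force
  qed
  with f g show ?thesis by (intro that) (simp add: L2_tendsto_def)
qed

text \<open>By orthonormality the squared norm of a difference of partial sums is a difference of
  partial sums of \<open>|c k|^2\<close>, so the Cauchy property is inherited. This supplies the
  function that is later identified with \<open>U \<psi>\<close>.\<close>

lemma L2_orthonormal_series:
  fixes e :: "int \<Rightarrow> 'a \<Rightarrow> complex"
  assumes e: "\<And>k. e k \<in> L2 M"
    and on: "\<And>j k. L2_inner M (e j) (e k) = (if j = k then 1 else 0)"
    and c: "(\<lambda>k. (cmod (c k))\<^sup>2) summable_on UNIV"
  obtains g where "L2_tendsto M (\<lambda>n x. \<Sum>k\<in>{- int n..int n}. c k * e k x) g sequentially"
proof -
  have norm: "(L2_norm M (\<lambda>x. \<Sum>k\<in>K. c k * e k x))\<^sup>2 = (\<Sum>k\<in>K. (cmod (c k))\<^sup>2)" if "finite K" for K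
  proof -
    have ce: "(\<lambda>x. c k * e k x) \<in> L2 M" for k by (intro L2_cmult e)
    have L2: "(\<lambda>x. \<Sum>k\<in>K. c k * e k x) \<in> L2 M" by (intro L2_sum ce)
    have 1: "L2_inner M (e j) (\<lambda>x. \<Sum>k\<in>K. c k * e k x) = cnj (c j)" if "j \<in> K" for j
    proof -
      have "L2_inner M (\<lambda>x. \<Sum>k\<in>K. c k * e k x) (e j) = (\<Sum>k\<in>K. c k * (if k = j then 1 else 0))"
        using ce e by (simp add: L2_inner_sum_left L2_inner_cmult_left on)
      also have "\<dots> = c j" using \<open>finite K\<close> that by (simp add: if_distrib cong: if_cong)
      finally show ?thesis by (metis L2_inner_cnj)
    qed
    have "complex_of_real ((L2_norm M (\<lambda>x. \<Sum>k\<in>K. c k * e k x))\<^sup>2) = (\<Sum>k\<in>K. c k * cnj (c k))"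
      unfolding L2_norm_inner using ce L2
      by (simp add: L2_inner_sum_left L2_inner_cmult_left 1 cong: sum.cong)
    then show ?thesis
      by (metis (mono_tags, lifting) complex_norm_square of_real_eq_iff of_real_sum sum.cong)
  qed
  let ?f = "\<lambda>n x. \<Sum>k\<in>{- int n..int n}. c k * e k x"
  obtain g where "L2_tendsto M ?f g sequentially"
  proof (rule L2_complete[of ?f M])
    show "?f n \<in> L2 M" for n by (intro L2_sum L2_cmult e)
    fix \<epsilon> :: real assume \<epsilon>: "\<epsilon> > 0"
    have "((\<lambda>k. (cmod (c k))\<^sup>2) has_sum (\<Sum>\<^sub>\<infinity>k. (cmod (c k))\<^sup>2)) UNIV"
      using c by (rule has_sum_infsum)
    then have "(\<lambda>n. \<Sum>k\<in>{- int n..int n}. (cmod (c k))\<^sup>2) \<longlonglongrightarrow> (\<Sum>\<^sub>\<infinity>k. (cmod (c k))\<^sup>2)"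
      unfolding has_sum_def by (rule filterlim_compose[OF _ filterlim_symmetric_intervals])
    then have "Cauchy (\<lambda>n. \<Sum>k\<in>{- int n..int n}. (cmod (c k))\<^sup>2)"
      by (intro convergent_Cauchy) (auto simp: convergent_def)
    from metric_CauchyD[OF this, of "\<epsilon>\<^sup>2"] obtain n0 where n0: "\<And>m n. n0 \<le> m \<Longrightarrow> n0 \<le> n \<Longrightarrow>
        \<bar>(\<Sum>k\<in>{- int m..int m}. (cmod (c k))\<^sup>2) - (\<Sum>k\<in>{- int n..int n}. (cmod (c k))\<^sup>2)\<bar> < \<epsilon>\<^sup>2"
      using \<epsilon> unfolding dist_real_def by auto
    show "\<exists>n0. \<forall>n\<ge>n0. \<forall>m\<ge>n. L2_norm M (\<lambda>x. ?f m x - ?f n x) \<le> \<epsilon>"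
    proof (intro exI[of _ n0] allI impI)
      fix n m assume "n0 \<le> n" "n \<le> m"
      then have sub: "{- int n..int n} \<subseteq> {- int m..int m}" by auto
      have eq: "(\<lambda>x. ?f m x - ?f n x) = (\<lambda>x. \<Sum>k\<in>{- int m..int m} - {- int n..int n}. c k * e k x)"
        using sub by (auto simp: sum_diff)
      have "(L2_norm M (\<lambda>x. ?f m x - ?f n x))\<^sup>2
          = (\<Sum>k\<in>{- int m..int m}. (cmod (c k))\<^sup>2) - (\<Sum>k\<in>{- int n..int n}. (cmod (c k))\<^sup>2)"
        unfolding eq sum_diff[OF finite_atLeastAtMost_int sub, symmetric] by (rule norm) simp
      then have "(L2_norm M (\<lambda>x. ?f m x - ?f n x))\<^sup>2 < \<epsilon>\<^sup>2"
        using n0[of m n] \<open>n0 \<le> n\<close> \<open>n \<le> m\<close> by linarith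
      then show "L2_norm M (\<lambda>x. ?f m x - ?f n x) \<le> \<epsilon>"
        using \<epsilon> by (intro less_imp_le) (auto intro: power2_less_imp_less)
    qed
  qed
  then show ?thesis by (rule that)
qed

section \<open>Uniqueness of Fourier coefficients\<close>

text \<open>Lifts a uniqueness theorem for nonnegative densities to complex functions, once for the
  circle and once for the line. As the family \<open>E\<close> is closed under conjugation, the
  transform of \<open>cnj h\<close> vanishes along with that of \<open>h\<close>, hence so does that
  of the real part; the positive and negative parts of the latter then have equal
  transforms.\<close>

lemma integrable_AE_zero_of_transform:
  fixes h :: "'a \<Rightarrow> complex" and E :: "'i \<Rightarrow> 'a \<Rightarrow> complex"
  assumes h: "integrable M h"
    and E: "\<And>i. E i \<in> borel_measurable M" "\<And>i. AE x in M. cmod (E i x) \<le> 1"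
    and cnj: "\<And>i. \<exists>j. AE x in M. E j x = cnj (E i x)"
    and determined: "\<And>(p :: 'a \<Rightarrow> real) (q :: 'a \<Rightarrow> real). integrable M p \<Longrightarrow> integrable M q \<Longrightarrow>
        (\<And>x. 0 \<le> p x) \<Longrightarrow> (\<And>x. 0 \<le> q x) \<Longrightarrow>
        (\<And>i. (LINT x|M. complex_of_real (p x) * E i x) = (LINT x|M. complex_of_real (q x) * E i x)) \<Longrightarrow> AE x in M. p x = q x"
    and zero: "\<And>i. (LINT x|M. h x * E i x) = 0"
  shows "AE x in M. h x = 0"
proof -
  have int: "integrable M (\<lambda>x. g x * E i x)" if "integrable M g" for g :: "'a \<Rightarrow> complex" and i
  proof (rule Bochner_Integration.integrable_bound[OF that])
    show "(\<lambda>x. g x * E i x) \<in> borel_measurable M" using that E by measurable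
    show "AE x in M. norm (g x * E i x) \<le> norm (g x)"
      using E(2)[of i] by eventually_elim (simp add: norm_mult mult_left_le)
  qed
  have Re: "AE x in M. Re (g x) = 0"
    if g: "integrable M g" and g0: "\<And>i. (LINT x|M. g x * E i x) = 0" for g
  proof -
    have r: "(LINT x|M. Re (g x) * E i x) = 0" for i
    proof -
      from cnj[of i] obtain j where j: "AE x in M. E j x = cnj (E i x)" by blast
      have "(LINT x|M. cnj (g x) * E i x) = cnj (LINT x|M. g x * cnj (E i x))"
        by (subst Bochner_Integration.integral_cnj[symmetric]) simp
      also have "(LINT x|M. g x * cnj (E i x)) = (LINT x|M. g x * E j x)"
        using g E j by (intro integral_cong_AE) (auto elim: eventually_mono)
      finally have c: "(LINT x|M. cnj (g x) * E i x) = 0" by (simp add: g0)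
      have "(LINT x|M. Re (g x) * E i x) = (LINT x|M. (g x * E i x + cnj (g x) * E i x) / 2)"
        by (intro Bochner_Integration.integral_cong) (auto simp: complex_eq_iff)
      also have "\<dots> = 0"
        using g by (simp add: int c g0)
      finally show ?thesis .
    qed
    have R: "integrable M (\<lambda>x. Re (g x))" using g by simp
    have "AE x in M. max 0 (Re (g x)) = max 0 (- Re (g x))"
    proof (rule determined[of "\<lambda>x. max 0 (Re (g x))" "\<lambda>x. max 0 (- Re (g x))"])
      show p: "integrable M (\<lambda>x. max 0 (Re (g x)))" and q: "integrable M (\<lambda>x. max 0 (- Re (g x)))"
        using R by auto
      fix i
      have "(LINT x|M. max 0 (Re (g x)) * E i x) - (LINT x|M. max 0 (- Re (g x)) * E i x)
          = (LINT x|M. max 0 (Re (g x)) * E i x - max 0 (- Re (g x)) * E i x)"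
        by (rule Bochner_Integration.integral_diff[symmetric]; rule int; use p q in simp)
      also have "\<dots> = (LINT x|M. Re (g x) * E i x)"
        by (intro Bochner_Integration.integral_cong) (auto simp: max_def algebra_simps)
      finally show "(LINT x|M. max 0 (Re (g x)) * E i x) = (LINT x|M. max 0 (- Re (g x)) * E i x)"
        by (simp add: r)
    qed auto
    then show ?thesis by eventually_elim (auto simp: max_def split: if_splits)
  qed
  \<comment> \<open>\<open>Re (- \<i> * h x)\<close> is \<open>Im (h x)\<close>, so the statement on
    real parts settles the imaginary part as well.\<close>
  have "AE x in M. Re (- \<i> * h x) = 0"
    using h zero by (intro Re) (simp_all add: mult.assoc)
  with Re[OF h zero] show ?thesis by eventually_elim (simp add: complex_eq_iff)
qed

lemma borel_measurable_power_int [measurable (raw)]: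
  fixes f :: "'a \<Rightarrow> complex"
  shows "f \<in> borel_measurable M \<Longrightarrow> (\<lambda>x. f x powi k) \<in> borel_measurable M"
  by (cases "k \<ge> 0") (simp_all add: power_int_def)

lemma bounded_linear_complex_real_on_circle:
  fixes f :: "complex \<Rightarrow> real"
  assumes "bounded_linear f"
  obtains \<alpha> \<beta> where "\<And>z. cmod z = 1 \<Longrightarrow> complex_of_real (f z) = \<alpha> * z + \<beta> * inverse z"
proof
  interpret bounded_linear f by fact
  fix z :: complex assume z: "cmod z = 1"
  have "f z = f (Re z *\<^sub>R 1 + Im z *\<^sub>R \<i>)"
    by (intro arg_cong[of _ _ f]) (simp add: complex_eq_iff)
  also have "\<dots> = Re z * f 1 + Im z * f \<i>" unfolding add scaleR by simp
  finally have f: "f z = Re z * f 1 + Im z * f \<i>" .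
  have inv: "inverse z = cnj z"
    using z complex_norm_square[of z] by (intro inverse_unique) simp
  \<comment> \<open>From \<open>Re z = (z + 1/z) / 2\<close> and
    \<open>Im z = (z - 1/z) / (2 * \<i>)\<close> on the unit circle.\<close>
  show "complex_of_real (f z) = ((f 1 - \<i> * f \<i>) / 2) * z + ((f 1 + \<i> * f \<i>) / 2) * inverse z"
    unfolding f inv by (simp add: complex_eq_iff algebra_simps add_divide_distrib diff_divide_distrib)
qed

text \<open>Moments with positive and negative exponents give the integrals of all polynomials in
  \<open>Re z\<close> and \<open>Im z\<close>; Stone-Weierstrass extends this to continuous
  functions, and continuous cutoffs to closed sets, which are stable under intersection and generate
  the Borel sets.\<close>

lemma finite_measures_on_circle_eqI:
  fixes M1 M2 :: "complex measure"
  assumes fin: "finite_measure M1" "finite_measure M2"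
    and sets: "sets M1 = sets borel" "sets M2 = sets borel"
    and circ: "AE z in M1. cmod z = 1" "AE z in M2. cmod z = 1"
    and moments: "\<And>k::int. (LINT z|M1. z powi k) = (LINT z|M2. z powi k)"
  shows "M1 = M2"
proof -
  note [simp] = measurable_cong_sets[OF sets(1) refl] measurable_cong_sets[OF sets(2) refl]
  interpret M1: finite_measure M1 by fact
  interpret M2: finite_measure M2 by fact
  \<comment> \<open>For \<open>k \<noteq> 0\<close> the function \<open>z powi k\<close> is
    unbounded on the plane; a bound on the circle suffices, since both measures are concentrated
    there.\<close>
  define bdd where "bdd H \<longleftrightarrow> H \<in> borel_measurable borel \<and> (\<exists>B. \<forall>z. cmod z = 1 \<longrightarrow> cmod (H z) \<le> B)"
    for H :: "complex \<Rightarrow> complex"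
  have bdd_int: "integrable M1 H" "integrable M2 H" if "bdd H" for H
    using that circ unfolding bdd_def
    by (auto intro!: M1.integrable_const_bound M2.integrable_const_bound elim!: eventually_mono)
  have bdd_add: "bdd (\<lambda>z. F z + G z)" if "bdd F" "bdd G" for F G
  proof -
    from that obtain A B where "\<And>z. cmod z = 1 \<Longrightarrow> cmod (F z) \<le> A" "\<And>z. cmod z = 1 \<Longrightarrow> cmod (G z) \<le> B"
      by (auto simp: bdd_def)
    then have "\<And>z. cmod z = 1 \<Longrightarrow> cmod (F z + G z) \<le> A + B" by (meson norm_triangle_mono)
    with that show ?thesis unfolding bdd_def by auto
  qed
  have bdd_mult: "bdd (\<lambda>z. F z * G z)" if "bdd F" "bdd G" for F G
  proof -
    from that obtain A B where "\<And>z. cmod z = 1 \<Longrightarrow> cmod (F z) \<le> A" "\<And>z. cmod z = 1 \<Longrightarrow> cmod (G z) \<le> B"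
      by (auto simp: bdd_def)
    then have "\<And>z. cmod z = 1 \<Longrightarrow> cmod (F z * G z) \<le> A * B"
      unfolding norm_mult by (meson mult_mono' norm_ge_zero order_trans)
    with that show ?thesis unfolding bdd_def by auto
  qed
  have bdd_const: "bdd (\<lambda>z. c)" for c
    by (auto simp: bdd_def)
  have bdd_powi: "bdd (\<lambda>z. z powi k)" for k
    by (auto simp: bdd_def norm_power_int intro!: exI[of _ 1])
  have bdd_real: "bdd (\<lambda>z. complex_of_real (f z))" if f: "continuous_on UNIV f" for f :: "complex \<Rightarrow> real"
  proof -
    have "compact (f ` sphere 0 1)"
      by (intro compact_continuous_image continuous_on_subset[OF f]) auto
    then obtain B where "\<And>z. cmod z = 1 \<Longrightarrow> \<bar>f z\<bar> \<le> B"
      by (force dest!: compact_imp_bounded simp: bounded_iff)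
    with borel_measurable_continuous_onI[OF f] show ?thesis unfolding bdd_def by auto
  qed
  txt \<open>The multipliers \<open>mul\<close> that preserve equality of all moments form an algebra, so it suffices
    to treat linear functionals, which are combinations of \<open>z\<close> and \<open>z\<^sup>-\<^sup>1\<close> on the circle.\<close>
  define same where "same H \<longleftrightarrow> bdd H \<and> (\<forall>k. (LINT z|M1. H z * z powi k) = (LINT z|M2. H z * z powi k))" for H
  define mul where "mul F \<longleftrightarrow> bdd F \<and> (\<forall>H. same H \<longrightarrow> same (\<lambda>z. F z * H z))" for F
  have same_1: "same (\<lambda>z. 1)" using moments by (simp add: same_def bdd_const)
  have same_add: "same (\<lambda>z. F z + G z)" if "same F" "same G" for F G
    using that unfolding same_def
    by (auto simp: distrib_right bdd_add bdd_int bdd_mult bdd_powi)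
  have same_cmult: "same (\<lambda>z. c * F z)" if "same F" for F c
    using that unfolding same_def by (auto simp: mult.assoc bdd_mult bdd_const)
  have poly: "mul (\<lambda>z. complex_of_real (f z))" if "real_polynomial_function f" for f
    using that
  proof induction
    case (linear f)
    obtain \<alpha> \<beta> where f: "\<And>z. cmod z = 1 \<Longrightarrow> complex_of_real (f z) = \<alpha> * z + \<beta> * inverse z"
      using bounded_linear_complex_real_on_circle[OF linear] by blast
    have b: "bdd (\<lambda>z. complex_of_real (f z))"
      using linear by (intro bdd_real) (rule bounded_linear.continuous_on, auto)
    have "(LINT z|M. complex_of_real (f z) * H z * z powi k) = \<alpha> * (LINT z|M. H z * z powi (k + 1)) + \<beta> * (LINT z|M. H z * z powi (k - 1))"
      if M: "M = M1 \<or> M = M2" and H: "same H" for M H k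
    proof -
      have AE: "AE z in M. cmod z = 1" and int: "\<And>G. bdd G \<Longrightarrow> integrable M G"
        and meas: "\<And>G::complex \<Rightarrow> complex. G \<in> borel_measurable borel \<Longrightarrow> G \<in> borel_measurable M"
        using M circ bdd_int by auto
      have H': "bdd H" using H by (simp add: same_def)
      have bl: "bdd (\<lambda>z. \<alpha> * (H z * z powi (k + 1)) + \<beta> * (H z * z powi (k - 1)))"
        by (intro bdd_add bdd_mult bdd_const H' bdd_powi)
      have br: "bdd (\<lambda>z. complex_of_real (f z) * H z * z powi k)"
        by (intro bdd_mult b H' bdd_powi)
      have "(LINT z|M. complex_of_real (f z) * H z * z powi k)
          = (LINT z|M. \<alpha> * (H z * z powi (k + 1)) + \<beta> * (H z * z powi (k - 1)))"
      proof (rule integral_cong_AE)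
        show "AE z in M. complex_of_real (f z) * H z * z powi k = \<alpha> * (H z * z powi (k + 1)) + \<beta> * (H z * z powi (k - 1))"
          using AE
        proof eventually_elim
          case (elim z)
          then have "z \<noteq> 0" by auto
          then show ?case
            unfolding f[OF elim] by (simp add: power_int_add power_int_diff field_simps)
        qed
      qed (use bl br in \<open>auto intro: meas simp: bdd_def\<close>)
      also have "\<dots> = \<alpha> * (LINT z|M. H z * z powi (k + 1)) + \<beta> * (LINT z|M. H z * z powi (k - 1))"
        using int H' by (simp add: bdd_mult bdd_powi)
      finally show ?thesis .
    qed
    then have "same (\<lambda>z. complex_of_real (f z) * H z)" if "same H" for H
      using that b bdd_mult unfolding same_def by simp
    with b show ?case by (simp add: mul_def)
  next
    case (const c)
    then show ?case by (auto simp: mul_def bdd_const same_cmult)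
  next
    case (add f g)
    then show ?case by (auto simp: mul_def bdd_add same_add distrib_right)
  next
    case (mult f g)
    then show ?case by (auto simp: mul_def bdd_mult mult.assoc)
  qed
  have cont: "(LINT z|M1. f z) = (LINT z|M2. f z)" if f: "continuous_on UNIV f" for f :: "complex \<Rightarrow> real"
  proof -
    let ?m = "measure M1 (space M1) + measure M2 (space M2)"
    have near: "\<bar>(LINT z|M1. f z) - (LINT z|M2. f z)\<bar> \<le> e * ?m" if e: "e > 0" for e
    proof -
      obtain g where g: "real_polynomial_function g" "\<And>z. z \<in> sphere 0 1 \<Longrightarrow> \<bar>f z - g z\<bar> < e"
        using Stone_Weierstrass_real_polynomial_function[OF compact_sphere[of "0::complex" 1] continuous_on_subset[OF f] e]
        by (metis subset_UNIV)
      have gc: "continuous_on UNIV g"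
        using g(1) by (simp add: continuous_at_imp_continuous_on continuous_real_polymonial_function)
      have "same (\<lambda>z. complex_of_real (g z) * 1)" using poly[OF g(1)] same_1 unfolding mul_def by blast
      then have "(LINT z|M1. complex_of_real (g z)) = (LINT z|M2. complex_of_real (g z))"
        unfolding same_def by (auto dest: spec[of _ 0])
      then have eq: "(LINT z|M1. g z) = (LINT z|M2. g z)" by (simp add: integral_complex_of_real)
      have est: "\<bar>(LINT z|M. f z) - (LINT z|M. g z)\<bar> \<le> e * measure M (space M)"
        if M: "M = M1 \<or> M = M2" for M
      proof -
        have AE: "AE z in M. cmod z = 1" and "finite_measure M"
          and int: "\<And>h::complex \<Rightarrow> real. continuous_on UNIV h \<Longrightarrow> integrable M h"
          using M circ fin bdd_int[OF bdd_real] by (auto simp: complex_of_real_integrable_eq)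
        interpret finite_measure M by fact
        have "\<bar>(LINT z|M. f z) - (LINT z|M. g z)\<bar> = \<bar>LINT z|M. f z - g z\<bar>"
          using int f gc by simp
        also have "\<dots> \<le> (LINT z|M. \<bar>f z - g z\<bar>)" by (rule integral_abs_bound)
        also have "\<dots> \<le> (LINT z|M. e)"
        proof (rule integral_mono_AE)
          show "AE z in M. \<bar>f z - g z\<bar> \<le> e"
            using AE by eventually_elim (auto intro!: less_imp_le g)
        qed (auto intro!: int f gc continuous_intros)
        finally show ?thesis by (simp add: mult.commute)
      qed
      show ?thesis using est[of M1] est[of M2] eq by (simp add: distrib_left)
    qed
    have "((\<lambda>e. e * ?m) \<longlongrightarrow> 0 * ?m) (at_right 0)" by (intro tendsto_intros)
    then have "\<bar>(LINT z|M1. f z) - (LINT z|M2. f z)\<bar> \<le> 0 * ?m"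
      by (rule tendsto_lowerbound) (auto simp: eventually_at_right_less near intro: eventually_mono[OF eventually_at_right_less])
    then show ?thesis by simp
  qed
  have closed: "emeasure M1 C = emeasure M2 C" if C: "closed C" for C
  \<comment> \<open>By convention \<open>infdist z {} = 0\<close>, so the cutoffs below would be
    constantly 1 for the empty set.\<close>
  proof (cases "C = {}")
    case False
    \<comment> \<open>These functions are 1 on \<open>C\<close>, and at each point off
      \<open>C\<close> they are eventually 0, because a closed set has positive distance from such a
      point.\<close>
    let ?f = "\<lambda>n z. max 0 (1 - real n * infdist z C)"
    have lim: "(\<lambda>n. LINT z|M. ?f n z) \<longlonglongrightarrow> measure M C" if "M = M1 \<or> M = M2" for M
    proof -
      have "finite_measure M" and sM: "sets M = sets borel" using that fin sets by auto
      interpret finite_measure M by fact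
      have [simp]: "space M = UNIV" using sM sets_eq_imp_space_eq[OF sM] by simp
      note [simp] = measurable_cong_sets[OF sM refl]
      have "(\<lambda>n. LINT z|M. ?f n z) \<longlonglongrightarrow> (LINT z|M. indicator C z)"
      proof (rule integral_dominated_convergence[where w = "\<lambda>_. 1"])
        show "?f n \<in> borel_measurable M" for n
          by simp (intro borel_measurable_continuous_onI continuous_intros)
        show "indicator C \<in> borel_measurable M" using C by simp
        show "AE z in M. (\<lambda>n. ?f n z) \<longlonglongrightarrow> indicator C z"
        proof (rule AE_I2)
          fix z
          show "(\<lambda>n. ?f n z) \<longlonglongrightarrow> indicator C z"
          proof (cases "z \<in> C")
            case False
            then have pos: "infdist z C > 0"
              using C \<open>C \<noteq> {}\<close> by (simp add: infdist_pos_not_in_closed)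
            then obtain n0 :: nat where "1 / infdist z C < n0" using reals_Archimedean2 by blast
            then have n0: "1 < n0 * infdist z C" using pos by (simp add: field_simps)
            have "\<forall>\<^sub>F n in sequentially. ?f n z = 0"
            proof (rule eventually_sequentiallyI[of n0])
              fix n assume "n0 \<le> n"
              then have "n0 * infdist z C \<le> n * infdist z C" using pos by (intro mult_right_mono) auto
              with n0 show "?f n z = 0" by simp
            qed
            with False show ?thesis by (simp add: tendsto_eventually)
          qed simp
        qed
        show "AE z in M. norm (?f n z) \<le> 1" for n by (auto simp: infdist_nonneg)
      qed simp
      then show ?thesis by simp
    qed
    have "(LINT z|M1. ?f n z) = (LINT z|M2. ?f n z)" for n
      by (intro cont continuous_intros)
    with lim[of M1] lim[of M2] have "measure M1 C = measure M2 C" by (auto intro: LIMSEQ_unique)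
    then show ?thesis by (simp add: M1.emeasure_eq_measure M2.emeasure_eq_measure)
  qed simp
  show ?thesis
  proof (rule measure_eqI_generator_eq[where E = "Collect closed" and \<Omega> = UNIV and A = "\<lambda>_. UNIV"])
    show "sets M1 = sigma_sets UNIV (Collect closed)" "sets M2 = sigma_sets UNIV (Collect closed)"
      using sets by (auto simp: borel_eq_closed)
  qed (auto simp: Int_stable_def closed)
qed

section \<open>Normalized Haar measure on the circle and its invariance\<close>

lemma circle_inverse: "cmod z = 1 \<Longrightarrow> inverse z = cnj z"
  using complex_norm_square[of z] by (intro inverse_unique) simp

lemma cnj_power_int_circle: "cmod z = 1 \<Longrightarrow> cnj (z powi k) = z powi (- k)"
  using circle_inverse[of z] by (simp add: power_int_minus power_int_inverse[symmetric])

lemma circle_eq_density: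
  "circle = distr (density lborel (\<lambda>t. ennreal (indicator {0..<2*pi} t / (2*pi)))) borel (\<lambda>t. exp (- \<i> * of_real t))"
proof -
  have "(indicator {0..<2*pi} t :: ennreal) / emeasure lborel {0..<2*pi} = ennreal (indicator {0..<2*pi} t / (2*pi))" for t :: real
    by (auto simp: indicator_def divide_ennreal[symmetric] simp flip: ennreal_1)
  then show ?thesis unfolding circle_def uniform_measure_def by presburger
qed

lemma sets_circle [measurable_cong, simp]: "sets circle = sets borel"
  by (simp add: circle_def)

lemma space_circle [simp]: "space circle = UNIV"
  by (simp add: circle_def)

lemma measurable_circle1 [simp]: "measurable circle N = measurable borel N"
  by (rule measurable_cong_sets) auto

lemma borel_measurable_cis_neg [measurable]: "(\<lambda>t. exp (- \<i> * complex_of_real t)) \<in> borel_measurable borel"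
  by (intro borel_measurable_continuous_onI continuous_intros)

lemma circle_integral:
  fixes F :: "complex \<Rightarrow> complex"
  assumes [measurable]: "F \<in> borel_measurable borel"
  shows "(LINT z|circle. F z) = (LINT t|lborel. indicator {0..<2*pi} t *\<^sub>R F (exp (- \<i> * of_real t))) / (2*pi)"
proof -
  have "(LINT z|circle. F z) = (LINT t|lborel. (indicator {0..<2*pi} t / (2*pi)) *\<^sub>R F (exp (- \<i> * of_real t)))"
    unfolding circle_eq_density by (simp add: integral_distr integral_density)
  also have "\<dots> = (LINT t|lborel. (1 / (2*pi)) *\<^sub>R (indicator {0..<2*pi} t *\<^sub>R F (exp (- \<i> * of_real t))))"
    by simp
  also have "\<dots> = (1 / (2*pi)) *\<^sub>R (LINT t|lborel. indicator {0..<2*pi} t *\<^sub>R F (exp (- \<i> * of_real t)))"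
    by (rule integral_scaleR_right)
  finally show ?thesis by (simp add: scaleR_conv_of_real)
qed

lemma circle_nn_integral:
  assumes [measurable]: "F \<in> borel_measurable borel"
  shows "(\<integral>\<^sup>+z. F z \<partial>circle) = ennreal (1 / (2*pi)) * (\<integral>\<^sup>+t. indicator {0..<2*pi} t * F (exp (- \<i> * of_real t)) \<partial>lborel)"
proof -
  have "(\<integral>\<^sup>+z. F z \<partial>circle) = (\<integral>\<^sup>+t. ennreal (indicator {0..<2*pi} t / (2*pi)) * F (exp (- \<i> * of_real t)) \<partial>lborel)"
    unfolding circle_eq_density by (simp add: nn_integral_distr nn_integral_density)
  also have "\<dots> = (\<integral>\<^sup>+t. ennreal (1 / (2*pi)) * (indicator {0..<2*pi} t * F (exp (- \<i> * of_real t))) \<partial>lborel)"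
    by (intro nn_integral_cong) (auto simp: indicator_def)
  finally show ?thesis by (simp add: nn_integral_cmult)
qed

lemma prob_space_circle: "prob_space circle"
  unfolding circle_def
  by (intro prob_space.prob_space_distr prob_space_uniform_measure) auto

lemma AE_circle: "AE z in circle. cmod z = 1"
  unfolding circle_def by (subst AE_distr_iff) (auto simp: norm_exp_eq_Re)

lemma circle_moment: "(LINT z|circle. z powi k) = (if k = 0 then 1 else 0)"
proof (cases "k = 0")
  case True
  interpret prob_space circle by (rule prob_space_circle)
  from True show ?thesis using prob_space by simp
next
  case False
  define F where "F t = \<i> / of_int k * exp (- \<i> * of_int k * complex_of_real t)" for t :: real
  have "(LINT t|lborel. indicator {0..<2*pi} t *\<^sub>R exp (- \<i> * of_real t) powi k)
      = (LINT t|lborel. indicator {0..2*pi} t *\<^sub>R exp (- \<i> * of_int k * of_real t))"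
  proof (rule integral_cong_AE)
    have "AE t in lborel. t \<noteq> 2*pi" by (rule AE_lborel_singleton)
    then show "AE t in lborel. indicator {0..<2*pi} t *\<^sub>R exp (- \<i> * of_real t) powi k
        = indicator {0..2*pi} t *\<^sub>R exp (- \<i> * of_int k * of_real t)"
      by eventually_elim (auto simp: indicator_def exp_power_int algebra_simps)
  qed measurable
  also have "\<dots> = F (2*pi) - F 0"
  proof (rule integral_FTC_Icc)
    show "(F has_vector_derivative exp (- \<i> * of_int k * of_real t)) (at t within {0..2*pi})" for t
      unfolding F_def using False
      by (auto intro!: derivative_eq_intros has_vector_derivative_real_field simp: field_simps)
  qed (auto intro!: continuous_intros)
  also have "\<dots> = 0"
    using exp_integer_2pi[of "of_int (- k)"] by (simp add: F_def algebra_simps)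
  finally show ?thesis using False by (simp add: circle_integral)
qed

text \<open>Reduces invariance of Haar measure to moments: under a rotation by \<open>c\<close> the
  moment of index \<open>k\<close> is multiplied by \<open>c powi k\<close>, and under
  \<open>z \<mapsto> z ^ n\<close> it becomes the moment of index \<open>n * k\<close>, so in both
  cases it stays 0 for \<open>k \<noteq> 0\<close>.\<close>

lemma circle_eqI:
  assumes "prob_space M" "sets M = sets borel" "AE z in M. cmod z = 1"
    and "\<And>k. k \<noteq> 0 \<Longrightarrow> (LINT z|M. z powi k) = 0"
  shows "M = circle"
proof -
  interpret M: prob_space M by fact
  interpret prob_space circle by (rule prob_space_circle)
  show ?thesis
  proof (rule finite_measures_on_circle_eqI)
    show "(LINT z|M. z powi k) = (LINT z|circle. z powi k)" for k
      using assms(4)[of k] M.prob_space by (simp add: circle_moment)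
  qed (use assms AE_circle in \<open>auto intro: M.finite_measure_axioms finite_measure_axioms\<close>)
qed

lemma circle_rotate:
  assumes c: "cmod c = 1"
  shows "distr circle circle (\<lambda>z. c * z) = circle"
proof (rule circle_eqI)
  show "prob_space (distr circle circle (\<lambda>z. c * z))"
    by (intro prob_space.prob_space_distr prob_space_circle) simp
  show "AE z in distr circle circle (\<lambda>z. c * z). cmod z = 1"
    using AE_circle c by (subst AE_distr_iff) (auto simp: norm_mult)
  show "(LINT z|distr circle circle (\<lambda>z. c * z). z powi k) = 0" if "k \<noteq> 0" for k
    using that by (subst integral_distr) (auto simp: power_int_mult_distrib circle_moment)
qed simp

lemma circle_power:
  assumes n: "n > 0"
  shows "distr circle circle (\<lambda>z. z ^ n) = circle"
proof (rule circle_eqI)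
  show "prob_space (distr circle circle (\<lambda>z. z ^ n))"
    by (intro prob_space.prob_space_distr prob_space_circle) simp
  show "AE z in distr circle circle (\<lambda>z. z ^ n). cmod z = 1"
    using AE_circle by (subst AE_distr_iff) (auto simp: norm_power elim!: eventually_mono)
  show "(LINT z|distr circle circle (\<lambda>z. z ^ n). z powi k) = 0" if "k \<noteq> 0" for k
  proof -
    have "(LINT z|circle. (z ^ n) powi k) = (LINT z|circle. z powi (int n * k))"
      by (simp add: power_int_mult)
    then show ?thesis using that n by (subst integral_distr) (auto simp: circle_moment)
  qed
qed simp

text \<open>An interval of length 1 is shorter than a period, so after rotation by
  \<open>exp (- \<i> * \<tau>)\<close> it fits into \<open>[0, 2*pi)\<close>; the factor
  \<open>2*pi\<close> undoes the normalization. This is the bridge that carries null sets and norm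
  bounds from the circle to the line.\<close>

lemma circle_local_bound:
  assumes [measurable]: "F \<in> borel_measurable borel"
  shows "(\<integral>\<^sup>+t. indicator {\<tau>..\<tau>+1} t * F (exp (- \<i> * of_real t)) \<partial>lborel) \<le> ennreal (2*pi) * (\<integral>\<^sup>+z. F z \<partial>circle)"
proof -
  let ?c = "exp (- \<i> * of_real \<tau>)"
  have "(\<integral>\<^sup>+t. indicator {\<tau>..\<tau>+1} t * F (exp (- \<i> * of_real t)) \<partial>lborel)
      = (\<integral>\<^sup>+t. indicator {\<tau>..\<tau>+1} (\<tau> + 1 * t) * F (exp (- \<i> * of_real (\<tau> + 1 * t))) \<partial>lborel)"
    by (subst nn_integral_real_affine[where c = 1 and t = \<tau>]) auto
  also have "\<dots> \<le> (\<integral>\<^sup>+t. indicator {0..<2*pi} t * F (?c * exp (- \<i> * of_real t)) \<partial>lborel)"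
    using pi_gt3 by (intro nn_integral_mono) (auto simp: indicator_def distrib_left exp_add[symmetric])
  also have "\<dots> = ennreal (2*pi) * (ennreal (1 / (2*pi)) * (\<integral>\<^sup>+t. indicator {0..<2*pi} t * F (?c * exp (- \<i> * of_real t)) \<partial>lborel))"
    by (simp add: mult.assoc[symmetric] ennreal_mult[symmetric])
  also have "\<dots> = ennreal (2*pi) * (\<integral>\<^sup>+z. F (?c * z) \<partial>circle)"
    by (subst circle_nn_integral) auto
  also have "(\<integral>\<^sup>+z. F (?c * z) \<partial>circle) = (\<integral>\<^sup>+z. F z \<partial>distr circle circle (\<lambda>z. ?c * z))"
    by (subst nn_integral_distr) auto
  finally show ?thesis by (simp add: circle_rotate norm_exp_eq_Re)
qed

text \<open>By \<open>circle_local_bound\<close> a null set of the circle pulls back to a null set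
  within each interval \<open>[n, n + 1]\<close>, and countably many of these cover the
  line.\<close>

lemma AE_circle_imp_AE_periodic:
  assumes "AE z in circle. P z"
  shows "AE t in lborel. P (exp (- \<i> * of_real t))"
proof -
  from assms obtain N where N: "{z. \<not> P z} \<subseteq> N" "N \<in> null_sets circle"
    unfolding eventually_ae_filter by auto
  then have [measurable]: "N \<in> sets borel" by auto
  have "AE t in lborel. indicator {real_of_int n..real_of_int n+1} t * (indicator N (exp (- \<i> * of_real t)) :: ennreal) = 0" for n
  proof -
    have "(\<integral>\<^sup>+t. indicator {real_of_int n..real_of_int n+1} t * indicator N (exp (- \<i> * of_real t)) \<partial>lborel) = 0"
      using circle_local_bound[of "indicator N" "real_of_int n"] N(2) by (simp add: null_sets_def)
    then show ?thesis by (subst (asm) nn_integral_0_iff_AE) auto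
  qed
  then have "AE t in lborel. \<forall>n. indicator {real_of_int n..real_of_int n+1} t * (indicator N (exp (- \<i> * of_real t)) :: ennreal) = 0"
    unfolding AE_all_countable by blast
  then show ?thesis
  proof eventually_elim
    case (elim t)
    have "t \<in> {real_of_int \<lfloor>t\<rfloor>..real_of_int \<lfloor>t\<rfloor>+1}" by simp
    with elim[rule_format, of "\<lfloor>t\<rfloor>"] have "exp (- \<i> * of_real t) \<notin> N"
      by (auto simp: indicator_def split: if_splits)
    with N(1) show ?case by auto
  qed
qed

text \<open>Nonnegative integrable densities with equal Fourier coefficients define finite measures
  on the circle with equal moments, hence the same measure.\<close>

lemma circle_fourier_unique:
  assumes h: "integrable circle h" and zero: "\<And>k. (LINT z|circle. h z * z powi k) = 0"
  shows "AE z in circle. h z = 0"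
proof (rule integrable_AE_zero_of_transform[OF h, of "\<lambda>k z. z powi k"])
  show "AE z in circle. cmod (z powi k) \<le> 1" for k
    using AE_circle by eventually_elim (simp add: norm_power_int)
  show "\<exists>j. AE z in circle. z powi j = cnj (z powi k)" for k
    using AE_circle
    by (intro exI[of _ "- k"]) (auto elim!: eventually_mono simp: cnj_power_int_circle simp del: complex_cnj_power_int)
  fix p q :: "complex \<Rightarrow> real"
  assume pq: "integrable circle p" "integrable circle q" "\<And>x. 0 \<le> p x" "\<And>x. 0 \<le> q x"
    and eq: "\<And>k. (LINT z|circle. p z * z powi k) = (LINT z|circle. q z * z powi k)"
  have [measurable]: "p \<in> borel_measurable borel" "q \<in> borel_measurable borel"
    using pq(1,2)[THEN borel_measurable_integrable] by auto
  have fin: "(\<integral>\<^sup>+z. ennreal (r z) \<partial>circle) < \<infinity>" if "integrable circle r" "\<And>z. 0 \<le> r z" for r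
    using that by (simp add: nn_integral_eq_integral)
  have fm: "finite_measure (density circle (\<lambda>z. ennreal (r z)))" if "integrable circle r" "\<And>z. 0 \<le> r z" for r
    using fin[OF that] borel_measurable_integrable[OF that(1)] by (intro finite_measureI) (simp add: emeasure_density)
  have "density circle (\<lambda>z. ennreal (p z)) = density circle (\<lambda>z. ennreal (q z))"
  proof (rule finite_measures_on_circle_eqI)
    show "AE z in density circle (\<lambda>z. ennreal (p z)). cmod z = 1" "AE z in density circle (\<lambda>z. ennreal (q z)). cmod z = 1"
      using AE_circle by (auto simp: AE_density elim: eventually_mono)
    show "(LINT z|density circle (\<lambda>z. ennreal (p z)). z powi k) = (LINT z|density circle (\<lambda>z. ennreal (q z)). z powi k)" for k
      using eq[of k] pq by (simp add: integral_density scaleR_conv_of_real)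
  qed (use pq fm in auto)
  then have "AE z in circle. ennreal (p z) = ennreal (q z)"
    using fin[of p] pq by (subst (asm) finite_density_unique) auto
  then show "AE z in circle. p z = q z"
    using pq by (auto elim!: eventually_mono)
qed (use zero in auto)

section \<open>Function spaces on the circle\<close>

lemma L2_circle_bounded_mult:
  assumes f: "f \<in> L2 circle" and [measurable]: "g \<in> borel_measurable borel"
    and bnd: "AE z in circle. cmod (g z) \<le> B"
  shows "(\<lambda>z. g z * f z) \<in> L2 circle"
proof -
  have [measurable]: "f \<in> borel_measurable borel" using L2_measurable[OF f] by simp
  have "integrable circle (\<lambda>z. (cmod (g z * f z))\<^sup>2)"
  proof (rule Bochner_Integration.integrable_bound)
    show "integrable circle (\<lambda>z. B\<^sup>2 * (cmod (f z))\<^sup>2)" using L2_integrable_sq[OF f] by simp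
    show "AE z in circle. norm ((cmod (g z * f z))\<^sup>2) \<le> norm (B\<^sup>2 * (cmod (f z))\<^sup>2)"
      using bnd by eventually_elim (auto simp: norm_mult power_mult_distrib intro!: mult_right_mono power_mono)
  qed measurable
  then show ?thesis by (simp add: L2_def)
qed

lemma L2_circle_one: "(\<lambda>z. 1) \<in> L2 circle"
proof -
  interpret prob_space circle by (rule prob_space_circle)
  show ?thesis by (simp add: L2_def)
qed

lemma AE_circle_powi: "AE z in circle. cmod (z powi k) \<le> 1"
  using AE_circle by eventually_elim (simp add: norm_power_int)

lemma L2_circle_mult_powi: "f \<in> L2 circle \<Longrightarrow> (\<lambda>z. z powi k * f z) \<in> L2 circle"
  by (rule L2_circle_bounded_mult[OF _ _ AE_circle_powi]) auto

lemma L2_circle_powi: "(\<lambda>z. z powi k) \<in> L2 circle"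
  using L2_circle_mult_powi[OF L2_circle_one, of k] by simp

lemma circle_powi_orthonormal:
  "L2_inner circle (\<lambda>z. z powi j) (\<lambda>z. z powi k) = (if j = k then 1 else 0)"
proof -
  have "L2_inner circle (\<lambda>z. z powi j) (\<lambda>z. z powi k) = (LINT z|circle. z powi (j - k))"
    unfolding L2_inner_def
  proof (rule integral_cong_AE)
    show "AE z in circle. z powi j * cnj (z powi k) = z powi (j - k)"
      using AE_circle
    proof eventually_elim
      case (elim z)
      then have "z \<noteq> 0" by auto
      then show ?case unfolding cnj_power_int_circle[OF elim] by (simp flip: power_int_add)
    qed
  qed measurable
  then show ?thesis by (simp add: circle_moment)
qed

lemma fourier_series_coefficient: "is_fourier_series c f \<Longrightarrow> L2_inner circle f (\<lambda>z. z powi j) = c j"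
  unfolding is_fourier_series_def
  by (rule orthonormal_coefficient) (simp_all add: L2_circle_powi circle_powi_orthonormal)

section \<open>Reflections, powers and roots on the circle\<close>

lemma circle_integral_reflect:
  fixes F :: "complex \<Rightarrow> 'b::{banach, second_countable_topology}"
  assumes "F \<in> borel_measurable borel"
  shows "(LINT z|circle. F (- z)) = (LINT z|circle. F z)"
proof -
  have "(LINT z|circle. F z) = (LINT z|distr circle circle (\<lambda>z. -1 * z). F z)"
    by (subst circle_rotate) auto
  also have "\<dots> = (LINT z|circle. F (- z))"
    using assms by (subst integral_distr) auto
  finally show ?thesis ..
qed

lemma circle_integral_odd:
  fixes F :: "complex \<Rightarrow> complex"
  assumes "F \<in> borel_measurable borel" "\<And>z. F (- z) = - F z"
  shows "(LINT z|circle. F z) = 0"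
  using circle_integral_reflect[OF assms(1)] by (simp add: assms(2))

lemma circle_integrable_reflect:
  fixes F :: "complex \<Rightarrow> 'b::{banach, second_countable_topology}"
  assumes "integrable circle F"
  shows "integrable circle (\<lambda>z. F (- z))"
proof -
  have "distr circle circle (\<lambda>z. -1 * z) = circle" by (rule circle_rotate) simp
  then have "integrable circle (\<lambda>z. F (-1 * z))"
    using assms by (intro integrable_distr[of _ circle circle]) simp_all
  then show ?thesis by simp
qed

lemma circle_integral_power:
  fixes F :: "complex \<Rightarrow> 'b::{banach, second_countable_topology}"
  assumes "F \<in> borel_measurable borel" "n > 0"
  shows "(LINT z|circle. F (z ^ n)) = (LINT z|circle. F z)"
proof -
  have "(LINT z|circle. F z) = (LINT z|distr circle circle (\<lambda>z. z ^ n). F z)"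
    using assms by (subst circle_power) auto
  also have "\<dots> = (LINT z|circle. F (z ^ n))"
    using assms by (subst integral_distr) auto
  finally show ?thesis ..
qed

lemma L2_circle_power:
  assumes f: "f \<in> L2 circle" and n: "n > 0"
  shows "(\<lambda>z. f (z ^ n)) \<in> L2 circle" "L2_norm circle (\<lambda>z. f (z ^ n)) = L2_norm circle f"
proof -
  have [measurable]: "f \<in> borel_measurable borel" using L2_measurable[OF f] by simp
  have "integrable (distr circle circle (\<lambda>z. z ^ n)) (\<lambda>z. (cmod (f z))\<^sup>2)"
    using n L2_integrable_sq[OF f] by (simp add: circle_power)
  then have "integrable circle (\<lambda>z. (cmod (f (z ^ n)))\<^sup>2)"
    by (rule integrable_distr[rotated]) simp
  then show "(\<lambda>z. f (z ^ n)) \<in> L2 circle" by (simp add: L2_def)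
  show "L2_norm circle (\<lambda>z. f (z ^ n)) = L2_norm circle f"
    unfolding L2_norm_def using n by (subst circle_integral_power[of "\<lambda>z. (cmod (f z))\<^sup>2"]) auto
qed

lemma sum_roots_measurable:
  fixes F :: "complex \<Rightarrow> real"
  assumes [measurable]: "F \<in> borel_measurable borel" and n: "n > 0"
  shows "(\<lambda>z. \<Sum>w | w ^ n = z. F w) \<in> borel_measurable borel"
proof -
  \<comment> \<open>A Borel choice of an \<open>n\<close>-th root: the principal branch off the
    nonpositive reals, where \<open>Ln\<close> is continuous, and on them the real root of
    \<open>- z\<close> turned by the angle \<open>pi / n\<close>. For \<open>z \<noteq> 0\<close>
    all roots are \<open>r z\<close> times the roots of unity, so the sum runs over a fixed finite
    index set; at 0 the roots collapse to one.\<close>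
  define r where "r z = (if z \<in> \<real>\<^sub>\<le>\<^sub>0 then of_real (root n (- Re z)) * exp (\<i> * pi / of_nat n) else exp (Ln z / of_nat n))" for z
  have [measurable]: "r \<in> borel_measurable borel"
    unfolding r_def[abs_def]
    by (intro borel_measurable_continuous_on_if continuous_intros) (use n in auto)
  have r: "r z ^ n = z" if "z \<noteq> 0" for z
  proof (cases "z \<in> \<real>\<^sub>\<le>\<^sub>0")
    case True
    then have "r z ^ n = of_real (root n (- Re z) ^ n) * exp (\<i> * pi / of_nat n) ^ n"
      by (simp add: r_def power_mult_distrib)
    also have "root n (- Re z) ^ n = - Re z"
      using True n by (intro real_root_pow_pos2) (auto elim!: nonpos_Reals_cases)
    also have "exp (\<i> * pi / of_nat n) ^ n = -1"
      using n by (simp add: exp_of_nat_mult[symmetric])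
    finally show ?thesis using True by (auto elim!: nonpos_Reals_cases)
  next
    case False
    then show ?thesis using n that by (simp add: r_def exp_of_nat_mult[symmetric])
  qed
  have "(\<Sum>w | w ^ n = z. F w) = (if z = 0 then F 0 else (\<Sum>\<zeta> | \<zeta> ^ n = 1. F (r z * \<zeta>)))" for z
  proof (cases "z = 0")
    case True
    then have "{w. w ^ n = z} = {0}" using n by auto
    with True show ?thesis by simp
  next
    case False
    then have "r z \<noteq> 0" using r[OF False] n by auto
    then have "bij_betw (\<lambda>\<zeta>. r z * \<zeta>) {\<zeta>. \<zeta> ^ n = 1} {w. w ^ n = z}"
      using r[OF False]
      by (intro bij_betwI[where g = "\<lambda>w. w / r z"]) (auto simp: power_mult_distrib power_divide False)
    from sum.reindex_bij_betw[OF this, of F] show ?thesis using False by simp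
  qed
  then show ?thesis by simp
qed

text \<open>Since \<open>z \<mapsto> z ^ n\<close> preserves Haar measure, \<open>z\<close> may be
  replaced by \<open>z ^ n\<close>, whose roots are the \<open>n\<close> products of
  \<open>z\<close> with roots of unity; each of these rotations contributes the integral of
  \<open>F\<close>.\<close>

lemma circle_integral_sum_roots:
  fixes F :: "complex \<Rightarrow> real"
  assumes F: "integrable circle F" and n: "n > 0"
  shows "(LINT z|circle. (\<Sum>w | w ^ n = z. F w)) = n * (LINT z|circle. F z)"
proof -
  have [measurable]: "F \<in> borel_measurable borel" using borel_measurable_integrable[OF F] by simp
  have rot: "integrable circle (\<lambda>z. F (\<zeta> * z)) \<and> (LINT z|circle. F (\<zeta> * z)) = (LINT z|circle. F z)"
    if "\<zeta> ^ n = 1" for \<zeta>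
  proof -
    have "cmod \<zeta> ^ n = 1" using that by (metis norm_one norm_power)
    then have "cmod \<zeta> = 1" using n by (intro power_eq_imp_eq_base[of _ n 1]) auto
    then have d: "distr circle circle (\<lambda>z. \<zeta> * z) = circle" by (rule circle_rotate)
    have "integrable circle (\<lambda>z. F (\<zeta> * z))"
      by (rule integrable_distr[of _ circle circle]) (simp_all add: d F)
    moreover have "(LINT z|circle. F z) = (LINT z|circle. F (\<zeta> * z))"
      by (subst d[symmetric], subst integral_distr) auto
    ultimately show ?thesis by simp
  qed
  have fin: "finite {\<zeta>::complex. \<zeta> ^ n = 1}" using n by (intro finite_roots_unity) simp
  have "(LINT z|circle. (\<Sum>w | w ^ n = z. F w)) = (LINT z|circle. (\<Sum>w | w ^ n = z ^ n. F w))"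
    by (rule circle_integral_power[OF sum_roots_measurable[OF _ n] n, symmetric]) measurable
  also have "\<dots> = (LINT z|circle. (\<Sum>\<zeta> | \<zeta> ^ n = 1. F (\<zeta> * z)))"
  proof (rule integral_cong_AE)
    show "(\<lambda>z. \<Sum>w | w ^ n = z ^ n. F w) \<in> borel_measurable circle"
      using measurable_compose[OF _ sum_roots_measurable[OF _ n, of F], of "\<lambda>z. z ^ n" borel] by simp
    show "AE z in circle. (\<Sum>w | w ^ n = z ^ n. F w) = (\<Sum>\<zeta> | \<zeta> ^ n = 1. F (\<zeta> * z))"
      using AE_circle
    proof eventually_elim
      case (elim z)
      then have z: "z \<noteq> 0" by auto
      have "bij_betw (\<lambda>\<zeta>. \<zeta> * z) {\<zeta>. \<zeta> ^ n = 1} {w. w ^ n = z ^ n}"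
        using z by (intro bij_betwI[where g = "\<lambda>w. w / z"]) (auto simp: power_mult_distrib power_divide)
      from sum.reindex_bij_betw[OF this, of F] show ?case by simp
    qed
  qed measurable
  also have "\<dots> = (\<Sum>\<zeta>\<in>{\<zeta>::complex. \<zeta> ^ n = 1}. LINT z|circle. F (\<zeta> * z))"
    by (rule Bochner_Integration.integral_sum) (use rot in auto)
  also have "\<dots> = (\<Sum>\<zeta>\<in>{\<zeta>::complex. \<zeta> ^ n = 1}. LINT z|circle. F z)"
    by (rule sum.cong) (use rot in auto)
  also have "\<dots> = n * (LINT z|circle. F z)"
    using n by (simp add: card_roots_unity_eq)
  finally show ?thesis .
qed

section \<open>The Fourier transform on the line\<close>

text \<open>Two nonnegative densities with equal transforms have the same mass, namely the transform
  at 0. Divided by it, they become distributions with equal characteristic functions, which Levy's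
  theorem identifies.\<close>

lemma real_fourier_unique:
  fixes h :: "real \<Rightarrow> complex"
  assumes h: "integrable lborel h" and zero: "\<And>\<tau>. (LINT x|lborel. h x * iexp (\<tau> * x)) = 0"
  shows "AE x in lborel. h x = 0"
proof (rule integrable_AE_zero_of_transform[OF h, of "\<lambda>\<tau> x. iexp (\<tau> * x)"])
  show "\<exists>\<tau>'. AE x in lborel. iexp (\<tau>' * x) = cnj (iexp (\<tau> * x))" for \<tau>
    by (rule exI[of _ "- \<tau>"]) (simp add: exp_cnj)
  fix p q :: "real \<Rightarrow> real"
  assume int: "integrable lborel p" "integrable lborel q" and pos: "\<And>x. 0 \<le> p x" "\<And>x. 0 \<le> q x"
    and eq: "\<And>\<tau>. (LINT x|lborel. p x * iexp (\<tau> * x)) = (LINT x|lborel. q x * iexp (\<tau> * x))"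
  have [measurable]: "p \<in> borel_measurable borel" "q \<in> borel_measurable borel"
    using int[THEN borel_measurable_integrable] by auto
  define c where "c = (LINT x|lborel. p x)"
  have c: "(LINT x|lborel. q x) = c" using eq[of 0] by (simp add: c_def)
  show "AE x in lborel. p x = q x"
  \<comment> \<open>Mass 0 cannot be normalized, but then both densities vanish almost
    everywhere.\<close>
  proof (cases "c = 0")
    case True
    then have "AE x in lborel. p x = 0" "AE x in lborel. q x = 0"
      using c pos integral_nonneg_eq_0_iff_AE[OF int(1)] integral_nonneg_eq_0_iff_AE[OF int(2)]
      by (auto simp: c_def)
    then show ?thesis by eventually_elim simp
  next
    case False
    then have cp: "c > 0" using pos by (simp add: c_def order_less_le)
    have dist: "real_distribution (density lborel (\<lambda>x. ennreal (r x / c)))"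
      if "integrable lborel r" "\<And>x. 0 \<le> r x" "(LINT x|lborel. r x) = c" for r
    proof (intro real_distribution.intro prob_spaceI real_distribution_axioms.intro)
      have [measurable]: "r \<in> borel_measurable borel"
        using that(1)[THEN borel_measurable_integrable] by auto
      show "emeasure (density lborel (\<lambda>x. ennreal (r x / c))) (space (density lborel (\<lambda>x. ennreal (r x / c)))) = 1"
        using that cp by (simp add: emeasure_density nn_integral_eq_integral)
    qed simp
    have char: "char (density lborel (\<lambda>x. ennreal (r x / c))) \<tau> = (LINT x|lborel. r x * iexp (\<tau> * x)) / c"
      if "integrable lborel r" "\<And>x. 0 \<le> r x" for r \<tau>
    proof -
      have [measurable]: "r \<in> borel_measurable borel"
        using that(1)[THEN borel_measurable_integrable] by auto
      show ?thesis
        using that cp unfolding char_def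
        by (subst integral_density) (auto simp: scaleR_conv_of_real)
    qed
    have "density lborel (\<lambda>x. ennreal (p x / c)) = density lborel (\<lambda>x. ennreal (q x / c))"
    proof (rule Levy_uniqueness)
      show "char (density lborel (\<lambda>x. ennreal (p x / c))) = char (density lborel (\<lambda>x. ennreal (q x / c)))"
        unfolding fun_eq_iff char[OF int(1) pos(1)] char[OF int(2) pos(2)] eq by simp
    qed (rule dist[OF int(1) pos(1) c_def[symmetric]] dist[OF int(2) pos(2) c])+
    then have "AE x in lborel. ennreal (p x / c) = ennreal (q x / c)"
      using cp int pos by (subst (asm) finite_density_unique) (auto simp: nn_integral_eq_integral)
    then show ?thesis
      using pos cp by (auto elim!: eventually_mono)
  qed
qed (use zero in auto)

section \<open>Transforms of interval indicators as test functions\<close>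

lemma integrable_inverse_1_plus_sq: "integrable lborel (\<lambda>x::real. 1 / (1 + x\<^sup>2))"
  using integrable_inverse_1_plus_square by (simp add: set_integrable_def inverse_eq_divide)

text \<open>The unnormalized Fourier transform of an interval indicator, a modulated sinc function.
  The length is a parameter because the substitution \<open>t \<mapsto> 2 * t\<close> in the
  definition of the mother function turns test intervals of length 1 into intervals of length
  2.\<close>

definition window :: "real \<Rightarrow> real \<Rightarrow> real \<Rightarrow> complex" where
  "window \<tau> L x = (LINT t|lborel. exp (- \<i> * of_real (x * t)) * indicator {\<tau>..\<tau>+L} t)"

lemma window_eq:
  assumes "L \<ge> 0" "x \<noteq> 0"
  shows "window \<tau> L x = exp (- \<i> * of_real (x * \<tau>)) * (1 - exp (- \<i> * of_real (x * L))) / (\<i> * of_real x)"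
proof -
  define F where "F t = exp (- \<i> * of_real (x * t)) * (\<i> / of_real x)" for t
  have "window \<tau> L x = (LINT t|lborel. indicator {\<tau>..\<tau>+L} t *\<^sub>R exp (- \<i> * of_real (x * t)))"
    unfolding window_def by (intro Bochner_Integration.integral_cong) (auto simp: indicator_def)
  also have "\<dots> = F (\<tau> + L) - F \<tau>"
  proof (rule integral_FTC_Icc)
    show "(F has_vector_derivative exp (- \<i> * of_real (x * t))) (at t within {\<tau>..\<tau>+L})" for t
      unfolding F_def using assms
      by (auto intro!: derivative_eq_intros has_vector_derivative_real_field simp: field_simps)
  qed (use assms in \<open>auto intro!: continuous_intros\<close>)
  also have "\<dots> = exp (- \<i> * of_real (x * \<tau>)) * (1 - exp (- \<i> * of_real (x * L))) / (\<i> * of_real x)"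
  proof -
    have "exp (- \<i> * of_real (x * (\<tau> + L))) = exp (- \<i> * of_real (x * \<tau>)) * exp (- \<i> * of_real (x * L))"
      by (simp add: exp_add[symmetric] algebra_simps)
    then show ?thesis using assms by (simp only: F_def) (simp add: field_simps)
  qed
  finally show ?thesis .
qed

lemma window_measurable [measurable]: "window \<tau> L \<in> borel_measurable borel"
  unfolding window_def by measurable

lemma window_bound: "L \<ge> 0 \<Longrightarrow> cmod (window \<tau> L x) \<le> L"
proof -
  assume L: "L \<ge> 0"
  have "cmod (window \<tau> L x) \<le> (LINT t|lborel. cmod (exp (- \<i> * of_real (x * t)) * indicator {\<tau>..\<tau>+L} t))"
    unfolding window_def by (rule integral_norm_bound)
  also have "\<dots> = (LINT t|lborel. indicator {\<tau>..\<tau>+L} t)"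
    by (intro Bochner_Integration.integral_cong) (auto simp: norm_mult norm_exp_eq_Re indicator_def)
  also have "\<dots> = L" using L by simp
  finally show ?thesis .
qed

lemma window_L2:
  assumes L: "L \<ge> 0"
  shows "window \<tau> L \<in> L2 lborel"
proof -
  have "integrable lborel (\<lambda>x. (cmod (window \<tau> L x))\<^sup>2)"
  proof (rule Bochner_Integration.integrable_bound)
    \<comment> \<open>The constant adds two bounds: the transform is at most \<open>L\<close>
      everywhere and at most \<open>2 / |x|\<close> away from 0, whence
      \<open>(1 + x^2) * |window|^2\<close> is at most \<open>L^2 + 4\<close>.\<close>
    show "integrable lborel (\<lambda>x. (L\<^sup>2 + 4) * (1 / (1 + x\<^sup>2)))"
      by (intro integrable_mult_right integrable_inverse_1_plus_sq)
    have "(cmod (window \<tau> L x))\<^sup>2 \<le> (L\<^sup>2 + 4) * (1 / (1 + x\<^sup>2))" for x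
    proof -
      have a: "(cmod (window \<tau> L x))\<^sup>2 \<le> L\<^sup>2"
        using window_bound[OF L] by (intro power_mono) auto
      have b: "x\<^sup>2 * (cmod (window \<tau> L x))\<^sup>2 \<le> 4"
      proof (cases "x = 0")
        case False
        have "cmod (1 - exp (- \<i> * of_real (x * L))) \<le> 2"
          by (rule order_trans[OF norm_triangle_ineq4]) (simp add: norm_exp_eq_Re)
        then have "(\<bar>x\<bar> * cmod (window \<tau> L x))\<^sup>2 \<le> 2\<^sup>2"
          using False unfolding window_eq[OF L False]
          by (intro power_mono) (simp_all add: norm_mult norm_divide norm_exp_eq_Re)
        then show ?thesis by (simp add: power_mult_distrib)
      qed simp
      have "1 + x\<^sup>2 > 0" by (simp add: add_pos_nonneg)
      with a b show ?thesis by (simp add: field_simps)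
    qed
    then show "AE x in lborel. norm ((cmod (window \<tau> L x))\<^sup>2) \<le> norm ((L\<^sup>2 + 4) * (1 / (1 + x\<^sup>2)))"
      by auto
  qed measurable
  then show ?thesis by (simp add: L2_def)
qed

lemma window_modulate: "window \<tau> L (x + y) = (LINT t|lborel. exp (- \<i> * of_real (x * t)) * (exp (- \<i> * of_real (y * t)) * indicator {\<tau>..\<tau>+L} t))"
  unfolding window_def
  by (intro Bochner_Integration.integral_cong) (auto simp: distrib_right distrib_left exp_add[symmetric])

lemma window_scale: "window (2 * \<tau>) (2 * L) x = 2 * window \<tau> L (2 * x)"
  unfolding window_def
  by (subst lborel_integral_real_affine[where c = 2 and t = 0])
     (auto intro!: Bochner_Integration.integral_cong simp: scaleR_conv_of_real indicator_def algebra_simps)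

text \<open>The multiplication formula, which moves the transform from \<open>f\<close> to the test
  function. For truncated transforms it is Fubini's theorem. As \<open>R\<close> grows, the left
  side converges because the truncated transforms do in L2, and the right side by dominated
  convergence, because \<open>f\<close> and the transform of \<open>G\<close> are both in
  L2.\<close>

lemma fourier_window:
  assumes F: "is_fourier f fh" and G [measurable]: "G \<in> borel_measurable borel"
    and supp: "\<And>t. t \<notin> {\<tau>..\<sigma>} \<Longrightarrow> G t = 0" and bnd: "\<And>t. cmod (G t) \<le> 1"
    and Gh: "(\<lambda>x. LINT t|lborel. exp (- \<i> * of_real (x * t)) * G t) \<in> L2 lborel"
  shows "(LINT t|lborel. fh t * G t)
    = complex_of_real (1 / sqrt (2*pi)) * (LINT x|lborel. f x * (LINT t|lborel. exp (- \<i> * of_real (x * t)) * G t))"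
proof -
  let ?c = "complex_of_real (1 / sqrt (2*pi))"
  let ?Gh = "\<lambda>x. LINT t|lborel. exp (- \<i> * of_real (x * t)) * G t"
  let ?fR = "\<lambda>R t. ?c * (LINT x:{-R..R}|lborel. exp (- \<i> * of_real (x * t)) * f x)"
  from F have f: "f \<in> L2 lborel" and lim: "L2_tendsto lborel ?fR fh at_top"
    by (auto simp: is_fourier_def)
  have fm [measurable]: "f \<in> borel_measurable borel" using L2_measurable[OF f] by simp
  have ind_L2: "(\<lambda>x. indicator {a..b} x :: complex) \<in> L2 lborel" for a b :: real
  proof -
    have "(\<lambda>x. (cmod (indicator {a..b} x))\<^sup>2) = (\<lambda>x. indicator {a..b} x :: real)"
      by (auto simp: indicator_def)
    then show ?thesis by (simp add: L2_def integrable_real_indicator emeasure_lborel_Icc_eq)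
  qed
  have Gint: "integrable lborel G"
  proof (rule Bochner_Integration.integrable_bound)
    show "integrable lborel (\<lambda>t. indicator {\<tau>..\<sigma>} t :: real)"
        by (simp add: integrable_real_indicator emeasure_lborel_Icc_eq)
    show "AE t in lborel. norm (G t) \<le> norm (indicator {\<tau>..\<sigma>} t :: real)"
      using supp bnd by (auto simp: indicator_def)
  qed measurable
  have GL2: "G \<in> L2 lborel"
  proof -
    have "integrable lborel (\<lambda>t. (cmod (G t))\<^sup>2)"
    proof (rule Bochner_Integration.integrable_bound)
      show "integrable lborel (\<lambda>t. indicator {\<tau>..\<sigma>} t :: real)"
        by (simp add: integrable_real_indicator emeasure_lborel_Icc_eq)
      show "AE t in lborel. norm ((cmod (G t))\<^sup>2) \<le> norm (indicator {\<tau>..\<sigma>} t :: real)"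
        using supp bnd by (auto simp: indicator_def power_le_one)
    qed measurable
    then show ?thesis by (simp add: L2_def)
  qed
  have inner: "L2_inner lborel (?fR R) (\<lambda>t. cnj (G t)) = ?c * (LINT x|lborel. indicator {-R..R} x * (f x * ?Gh x))" for R
  proof -
    let ?K = "\<lambda>x t. indicator {-R..R} x * f x * exp (- \<i> * of_real (x * t)) * G t"
    \<comment> \<open>An L2 function is integrable over a bounded interval; together with the
      integrability of \<open>G\<close> this makes the kernel integrable on the product.\<close>
    have fR: "integrable lborel (\<lambda>x. indicator {-R..R} x * f x)"
      by (rule L2_mult_integrable[OF ind_L2 f])
    have "integrable (lborel \<Otimes>\<^sub>M lborel) (case_prod ?K)"
    proof (rule lborel_pair.Fubini_integrable)
      show "case_prod ?K \<in> borel_measurable (lborel \<Otimes>\<^sub>M lborel)" by measurable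
      have "(\<lambda>x. LINT t|lborel. norm (case_prod ?K (x, t))) = (\<lambda>x. cmod (indicator {-R..R} x * f x) * (LINT t|lborel. cmod (G t)))"
        by (simp add: norm_mult norm_exp_eq_Re)
      then show "integrable lborel (\<lambda>x. LINT t|lborel. norm (case_prod ?K (x, t)))"
        using fR by (simp add: integrable_norm)
      show "AE x in lborel. integrable lborel (\<lambda>t. case_prod ?K (x, t))"
      proof (rule AE_I2)
        fix x
        have "integrable lborel (\<lambda>t. exp (- \<i> * of_real (x * t)) * G t)"
          by (rule Bochner_Integration.integrable_bound[OF Gint]) (auto simp: norm_mult norm_exp_eq_Re)
        then show "integrable lborel (\<lambda>t. case_prod ?K (x, t))"
          unfolding prod.case mult.assoc by (intro integrable_mult_right) simp_all
      qed
    qed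
    then have "(LINT t|lborel. LINT x|lborel. ?K x t) = (LINT x|lborel. LINT t|lborel. ?K x t)"
      by (rule lborel_pair.Fubini_integral)
    moreover have "(LINT t|lborel. LINT x|lborel. ?K x t)
        = (LINT t|lborel. (LINT x:{-R..R}|lborel. exp (- \<i> * of_real (x * t)) * f x) * G t)"
    proof (intro Bochner_Integration.integral_cong refl)
      fix t
      have "(LINT x|lborel. ?K x t) = (LINT x|lborel. (indicator {-R..R} x *\<^sub>R (exp (- \<i> * of_real (x * t)) * f x)) * G t)"
        by (intro Bochner_Integration.integral_cong) (auto simp: indicator_def)
      then show "(LINT x|lborel. ?K x t) = (LINT x:{-R..R}|lborel. exp (- \<i> * of_real (x * t)) * f x) * G t"
        unfolding set_lebesgue_integral_def integral_mult_left_zero .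
    qed
    moreover have "(LINT x|lborel. LINT t|lborel. ?K x t) = (LINT x|lborel. indicator {-R..R} x * (f x * ?Gh x))"
      unfolding mult.assoc by simp
    ultimately have "(LINT t|lborel. (LINT x:{-R..R}|lborel. exp (- \<i> * of_real (x * t)) * f x) * G t)
        = (LINT x|lborel. indicator {-R..R} x * (f x * ?Gh x))" by simp
    then show ?thesis unfolding L2_inner_def by (simp add: mult.assoc)
  qed
  have lim1: "((\<lambda>R. L2_inner lborel (?fR R) (\<lambda>t. cnj (G t))) \<longlongrightarrow> L2_inner lborel fh (\<lambda>t. cnj (G t))) at_top"
    by (intro L2_tendsto_inner lim L2_cnj GL2)
  have lim2: "((\<lambda>R. LINT x|lborel. indicator {-R..R} x * (f x * ?Gh x)) \<longlongrightarrow> (LINT x|lborel. f x * ?Gh x)) at_top"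
  proof (rule integral_dominated_convergence_at_top)
    have int: "integrable lborel (\<lambda>x. f x * ?Gh x)" by (rule L2_mult_integrable[OF f Gh])
    then show "integrable lborel (\<lambda>x. cmod (f x * ?Gh x))" by (rule integrable_norm)
    show "\<forall>\<^sub>F R in at_top. AE x in lborel. norm (indicator {-R..R} x * (f x * ?Gh x)) \<le> cmod (f x * ?Gh x)"
      by (intro always_eventually allI AE_I2) (auto simp: indicator_def)
    show "AE x in lborel. ((\<lambda>R. indicator {-R..R} x * (f x * ?Gh x)) \<longlongrightarrow> f x * ?Gh x) at_top"
    proof (rule AE_I2, rule tendsto_eventually)
      fix x :: real
      show "\<forall>\<^sub>F R in at_top. indicator {-R..R} x * (f x * ?Gh x) = f x * ?Gh x"
        using eventually_ge_at_top[of "\<bar>x\<bar>"] by eventually_elim (auto simp: indicator_def)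
    qed
  qed measurable
  show ?thesis
    using tendsto_unique[OF trivial_limit_at_top_linorder lim1[unfolded inner] tendsto_mult_left[OF lim2]]
    by (simp add: L2_inner_def)
qed

lemma L2_translate:
  fixes f :: "real \<Rightarrow> complex"
  assumes "f \<in> L2 lborel"
  shows "(\<lambda>x. f (x + c)) \<in> L2 lborel"
  using assms lborel_integrable_real_affine[of "\<lambda>x. (cmod (f x))\<^sup>2" 1 c]
  by (auto simp: L2_def add.commute)

lemma L2_dilate:
  fixes f :: "real \<Rightarrow> complex"
  assumes "f \<in> L2 lborel" "c \<noteq> 0"
  shows "(\<lambda>x. f (c * x)) \<in> L2 lborel"
  using assms lborel_integrable_real_affine[of "\<lambda>x. (cmod (f x))\<^sup>2" c 0]
  by (auto simp: L2_def)

text \<open>Cutting a periodic function down to an interval of length 1 is bounded from L2 of the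
  circle to L2 of the line, with norm at most \<open>sqrt (2*pi)\<close>, and it is linear.\<close>

lemma L2_tendsto_circle_window:
  assumes "L2_tendsto circle u f F"
  shows "L2_tendsto lborel (\<lambda>i t. u i (exp (- \<i> * of_real t)) * indicator {\<tau>..\<tau>+1} t)
    (\<lambda>t. f (exp (- \<i> * of_real t)) * indicator {\<tau>..\<tau>+1} t) F"
proof -
  let ?w = "\<lambda>h t. h (exp (- \<i> * complex_of_real t)) * (indicator {\<tau>..\<tau>+1} t :: complex)"
  have w: "?w h \<in> L2 lborel \<and> (L2_norm lborel (?w h))\<^sup>2 \<le> 2 * pi * (L2_norm circle h)\<^sup>2" if h: "h \<in> L2 circle" for h
  proof -
    have [measurable]: "h \<in> borel_measurable borel" using L2_measurable[OF h] by simp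
    have "(\<integral>\<^sup>+t. ennreal ((cmod (?w h t))\<^sup>2) \<partial>lborel)
        = (\<integral>\<^sup>+t. indicator {\<tau>..\<tau>+1} t * ennreal ((cmod (h (exp (- \<i> * of_real t))))\<^sup>2) \<partial>lborel)"
      by (intro nn_integral_cong) (auto simp: indicator_def)
    also have "\<dots> \<le> ennreal (2*pi) * (\<integral>\<^sup>+z. ennreal ((cmod (h z))\<^sup>2) \<partial>circle)"
      by (rule circle_local_bound) measurable
    also have "\<dots> = ennreal (2 * pi * (L2_norm circle h)\<^sup>2)"
      using L2_integrable_sq[OF h] by (simp add: nn_integral_eq_integral L2_norm_sq ennreal_mult)
    finally have le: "(\<integral>\<^sup>+t. ennreal ((cmod (?w h t))\<^sup>2) \<partial>lborel) \<le> ennreal (2 * pi * (L2_norm circle h)\<^sup>2)" .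
    have L2: "?w h \<in> L2 lborel"
      using le by (auto simp: L2_def integrable_iff_bounded intro: le_less_trans)
    show ?thesis
      using le L2 L2_integrable_sq[OF L2] by (auto simp: nn_integral_eq_integral L2_norm_sq)
  qed
  from assms have f: "f \<in> L2 circle" and u: "\<forall>\<^sub>F i in F. u i \<in> L2 circle"
    and lim: "((\<lambda>i. L2_norm circle (\<lambda>x. u i x - f x)) \<longlongrightarrow> 0) F" by (auto simp: L2_tendsto_def)
  have "((\<lambda>i. L2_norm lborel (\<lambda>t. ?w (u i) t - ?w f t)) \<longlongrightarrow> 0) F"
  proof (rule Lim_null_comparison)
    show "\<forall>\<^sub>F i in F. norm (L2_norm lborel (\<lambda>t. ?w (u i) t - ?w f t)) \<le> sqrt (2*pi) * L2_norm circle (\<lambda>x. u i x - f x)"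
      using u
    proof eventually_elim
      case (elim i)
      have "(L2_norm lborel (\<lambda>t. ?w (u i) t - ?w f t))\<^sup>2 \<le> (sqrt (2*pi) * L2_norm circle (\<lambda>x. u i x - f x))\<^sup>2"
        using w[OF L2_diff[OF elim f]] by (simp add: power_mult_distrib left_diff_distrib)
      then show ?case by (auto intro: power2_le_imp_le)
    qed
    show "((\<lambda>i. sqrt (2*pi) * L2_norm circle (\<lambda>x. u i x - f x)) \<longlongrightarrow> 0) F"
      using tendsto_mult_right_zero[OF lim] by simp
  qed
  with f u w show ?thesis by (auto simp: L2_tendsto_def elim: eventually_mono)
qed

lemma U_L2: "f \<in> L2 lborel \<Longrightarrow> U f \<in> L2 lborel"
  unfolding U_def using L2_cmult[OF L2_dilate[of f "1/2"]] by simp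

lemma translate_L2: "f \<in> L2 lborel \<Longrightarrow> translate f k \<in> L2 lborel"
  unfolding translate_def using L2_translate[of f "- of_int k"] by simp

text \<open>Up to modulation by \<open>\<tau>\<close>, \<open>window \<tau> 1\<close> is one fixed function whose zeros form a
  null set.\<close>

lemma L2_fourier_window_zero:
  assumes D: "D \<in> L2 lborel" and zero: "\<And>\<tau>. (LINT x|lborel. D x * window \<tau> 1 x) = 0"
  shows "AE x in lborel. D x = 0"
proof -
  have factor: "AE x in lborel. window \<tau> 1 x = iexp (- \<tau> * x) * window 0 1 x" for \<tau>
  proof -
    have "AE x in lborel. x \<noteq> (0::real)" by (rule AE_lborel_singleton)
    then show ?thesis by eventually_elim (simp add: window_eq mult.commute)
  qed
  have [measurable]: "D \<in> borel_measurable borel" using L2_measurable[OF D] by simp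
  have "AE x in lborel. D x * window 0 1 x = 0"
  proof (rule real_fourier_unique)
    show "integrable lborel (\<lambda>x. D x * window 0 1 x)"
      by (intro L2_mult_integrable D window_L2) simp
    fix \<tau>
    have "(LINT x|lborel. D x * window 0 1 x * iexp (\<tau> * x)) = (LINT x|lborel. D x * window (- \<tau>) 1 x)"
      by (intro integral_cong_AE) (use factor[of "- \<tau>"] in \<open>auto elim!: eventually_mono simp: mult_ac\<close>)
    then show "(LINT x|lborel. D x * window 0 1 x * iexp (\<tau> * x)) = 0" by (simp add: zero)
  qed
  moreover have "AE x in lborel. window 0 1 x \<noteq> 0"
  proof -
    \<comment> \<open>Zeros can occur only where \<open>exp (- \<i> * x) = 1\<close>. Discarding all
      multiples of \<open>2*pi\<close> also discards 0, where \<open>window_eq\<close> gives no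
      formula.\<close>
    have "AE x in lborel. x \<notin> (range (\<lambda>n::int. 2 * pi * n))"
      by (intro AE_not_in countable_imp_null_set_lborel) auto
    then show ?thesis
    proof eventually_elim
      case (elim x)
      have "x \<noteq> 0" using elim by (metis mult_zero_right of_int_0 rangeI)
      moreover have "exp (- \<i> * of_real x) \<noteq> 1"
      proof
        assume "exp (- \<i> * of_real x) = 1"
        then obtain n :: int where "- x = of_int (2 * n) * pi" by (auto simp: exp_eq_1)
        then have "x = 2 * pi * of_int (- n)" by (simp add: mult_ac)
        with elim show False by blast
      qed
      ultimately show ?case by (simp add: window_eq)
    qed
  qed
  ultimately show ?thesis by eventually_elim simp
qed

text \<open>Both sides have the same integral against every \<open>window \<tau> 1\<close>. The
  exponents \<open>s k\<close> and the index sets \<open>K n\<close> are left free because the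
  coefficients of \<open>m1\<close> appear at \<open>1 - k\<close>, a substitution that does not
  preserve symmetric intervals.\<close>

lemma fourier_symbol_expansion:
  fixes d :: "int \<Rightarrow> complex" and s :: "int \<Rightarrow> int"
  assumes \<phi>: "is_fourier \<phi> \<phi>h" and \<psi>: "is_fourier \<psi> \<psi>h"
    and eq: "AE t in lborel. complex_of_real (sqrt 2) * \<psi>h (2 * t) = periodic m t * \<phi>h t"
    and g: "L2_tendsto lborel (\<lambda>n x. \<Sum>k\<in>K n. d k * translate \<phi> (s k) x) g sequentially"
    and m: "L2_tendsto circle (\<lambda>n z. \<Sum>k\<in>K n. d k * z powi s k) m sequentially"
  shows "AE x in lborel. g x = U \<psi> x"
proof -
  let ?c = "complex_of_real (1 / sqrt (2*pi))"
  have L2: "\<phi> \<in> L2 lborel" "\<psi> \<in> L2 lborel" "\<phi>h \<in> L2 lborel" "\<psi>h \<in> L2 lborel" "g \<in> L2 lborel" "m \<in> L2 circle"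
    using \<phi> \<psi> g m by (auto simp: is_fourier_def L2_tendsto_def)
  have [measurable]: "\<phi> \<in> borel_measurable borel" "\<psi> \<in> borel_measurable borel" "\<phi>h \<in> borel_measurable borel"
    "\<psi>h \<in> borel_measurable borel" "m \<in> borel_measurable borel"
    using L2[THEN L2_measurable] by auto
  have win: "(LINT x|lborel. (g x - U \<psi> x) * window \<tau> 1 x) = 0" for \<tau>
  proof -
    let ?I = "\<lambda>t. indicator {\<tau>..\<tau>+1} t :: complex"
    \<comment> \<open>Translation of \<open>\<phi>\<close> by \<open>j\<close> is moved to the
      argument of the window, where it becomes modulation of the indicator by
      \<open>exp (- \<i> * j * t)\<close>.\<close>
    have coef: "?c * (LINT x|lborel. translate \<phi> j x * window \<tau> 1 x)
        = (LINT t|lborel. exp (- \<i> * of_real t) powi j * ?I t * \<phi>h t)" for j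
    proof -
      have "(LINT t|lborel. \<phi>h t * (exp (- \<i> * complex_of_real (real_of_int j * t)) * ?I t))
          = ?c * (LINT x|lborel. \<phi> x * window \<tau> 1 (x + real_of_int j))"
        unfolding window_modulate
      proof (rule fourier_window[OF \<phi>, where \<tau> = \<tau> and \<sigma> = "\<tau> + 1"])
        show "(\<lambda>x. LINT t|lborel. exp (- \<i> * of_real (x * t)) * (exp (- \<i> * complex_of_real (real_of_int j * t)) * ?I t)) \<in> L2 lborel"
          unfolding window_modulate[symmetric] by (intro L2_translate window_L2) simp
        show "exp (- \<i> * complex_of_real (real_of_int j * t)) * ?I t = 0" if "t \<notin> {\<tau>..\<tau>+1}" for t using that by simp
        show "cmod (exp (- \<i> * complex_of_real (real_of_int j * t)) * ?I t) \<le> 1" for t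
          by (simp add: norm_mult norm_exp_eq_Re indicator_def)
      qed measurable
      also have "(LINT x|lborel. \<phi> x * window \<tau> 1 (x + real_of_int j)) = (LINT x|lborel. translate \<phi> j x * window \<tau> 1 x)"
        by (subst lborel_integral_real_affine[where c = 1 and t = "- of_int j"])
           (auto simp: translate_def algebra_simps)
      finally have "?c * (LINT x|lborel. translate \<phi> j x * window \<tau> 1 x)
          = (LINT t|lborel. \<phi>h t * (exp (- \<i> * complex_of_real (real_of_int j * t)) * ?I t))" by simp
      also have "\<dots> = (LINT t|lborel. exp (- \<i> * of_real t) powi j * ?I t * \<phi>h t)"
        by (intro Bochner_Integration.integral_cong) (auto simp: exp_power_int algebra_simps)
      finally show ?thesis .
    qed
    have wL2: "(\<lambda>x. cnj (window \<tau> 1 x)) \<in> L2 lborel" by (intro L2_cnj window_L2) simp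
    have p: "(\<lambda>t. exp (- \<i> * of_real t) powi j * ?I t) \<in> L2 lborel" for j
    proof -
      have "(\<lambda>t. (cmod (exp (- \<i> * of_real t) powi j * ?I t))\<^sup>2) = (\<lambda>t. indicator {\<tau>..\<tau>+1} t)"
        by (auto simp: indicator_def norm_power_int norm_mult norm_exp_eq_Re)
      then show ?thesis by (simp add: L2_def integrable_real_indicator emeasure_lborel_Icc_eq)
    qed
    have lim1: "(\<lambda>n. ?c * L2_inner lborel (\<lambda>x. \<Sum>k\<in>K n. d k * translate \<phi> (s k) x) (\<lambda>x. cnj (window \<tau> 1 x)))
        \<longlonglongrightarrow> ?c * L2_inner lborel g (\<lambda>x. cnj (window \<tau> 1 x))"
      by (intro tendsto_intros L2_tendsto_inner g wL2)
    have partial: "?c * L2_inner lborel (\<lambda>x. \<Sum>k\<in>K n. d k * translate \<phi> (s k) x) (\<lambda>x. cnj (window \<tau> 1 x))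
        = L2_inner lborel (\<lambda>t. (\<Sum>k\<in>K n. d k * exp (- \<i> * of_real t) powi s k) * ?I t) (\<lambda>t. cnj (\<phi>h t))" for n
    proof -
      have "?c * L2_inner lborel (\<lambda>x. \<Sum>k\<in>K n. d k * translate \<phi> (s k) x) (\<lambda>x. cnj (window \<tau> 1 x))
          = (\<Sum>k\<in>K n. d k * (?c * (LINT x|lborel. translate \<phi> (s k) x * window \<tau> 1 x)))"
        using wL2 by (simp add: L2_inner_sum_left L2_cmult translate_L2 L2 L2_inner_cmult_left sum_distrib_left)
          (simp add: L2_inner_def mult_ac)
      also have "\<dots> = (\<Sum>k\<in>K n. d k * L2_inner lborel (\<lambda>t. exp (- \<i> * of_real t) powi s k * ?I t) (\<lambda>t. cnj (\<phi>h t)))"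
        unfolding coef by (simp add: L2_inner_def)
      also have "\<dots> = L2_inner lborel (\<lambda>t. \<Sum>k\<in>K n. d k * (exp (- \<i> * of_real t) powi s k * ?I t)) (\<lambda>t. cnj (\<phi>h t))"
        using p L2 by (subst L2_inner_sum_left) (auto intro: L2_cmult L2_cnj simp: L2_inner_cmult_left)
      finally show ?thesis by (simp add: sum_distrib_right mult.assoc)
    qed
    have lim2: "(\<lambda>n. L2_inner lborel (\<lambda>t. (\<Sum>k\<in>K n. d k * exp (- \<i> * of_real t) powi s k) * ?I t) (\<lambda>t. cnj (\<phi>h t)))
        \<longlonglongrightarrow> L2_inner lborel (\<lambda>t. m (exp (- \<i> * of_real t)) * ?I t) (\<lambda>t. cnj (\<phi>h t))"
      by (intro L2_tendsto_inner L2_tendsto_circle_window[OF m] L2_cnj L2)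
    have "?c * L2_inner lborel g (\<lambda>x. cnj (window \<tau> 1 x))
        = L2_inner lborel (\<lambda>t. m (exp (- \<i> * of_real t)) * ?I t) (\<lambda>t. cnj (\<phi>h t))"
      by (rule LIMSEQ_unique[OF lim1[unfolded partial] lim2])
    then have gw: "?c * (LINT x|lborel. g x * window \<tau> 1 x) = (LINT t|lborel. m (exp (- \<i> * of_real t)) * ?I t * \<phi>h t)"
      by (simp add: L2_inner_def)
    \<comment> \<open>Here the relation between the two transforms enters; the remaining steps undo
      the dilation by 2, before and after passing from the transform back to
      \<open>\<psi>\<close>.\<close>
    have "(LINT t|lborel. m (exp (- \<i> * of_real t)) * ?I t * \<phi>h t) = (LINT t|lborel. complex_of_real (sqrt 2) * (\<psi>h (2 * t) * ?I t))"
      by (intro integral_cong_AE) (use eq in \<open>auto simp: periodic_def mult_ac elim!: eventually_mono\<close>)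
    also have "\<dots> = complex_of_real (sqrt 2) * (LINT t|lborel. \<psi>h (2 * t) * ?I t)"
      by simp
    also have "(LINT t|lborel. \<psi>h (2 * t) * ?I t) = (LINT t|lborel. \<psi>h t * indicator {2*\<tau>..2*\<tau>+2*1} t) / 2"
      by (subst (2) lborel_integral_real_affine[where c = 2 and t = 0])
         (auto intro!: Bochner_Integration.integral_cong simp: indicator_def scaleR_conv_of_real)
    also have "(LINT t|lborel. \<psi>h t * indicator {2*\<tau>..2*\<tau>+2*1} t) = ?c * (LINT x|lborel. \<psi> x * window (2*\<tau>) (2*1) x)"
      unfolding window_def
    proof (rule fourier_window[OF \<psi>, where \<tau> = "2*\<tau>" and \<sigma> = "2*\<tau>+2*1"])
      show "(\<lambda>x. LINT t|lborel. exp (- \<i> * of_real (x * t)) * indicator {2*\<tau>..2*\<tau>+2*1} t) \<in> L2 lborel"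
        using window_L2[of "2*1" "2*\<tau>"] unfolding window_def by simp
    qed (auto simp: indicator_def)
    also have "(LINT x|lborel. \<psi> x * window (2*\<tau>) (2*1) x) = (LINT x|lborel. \<psi> (x / 2) * window \<tau> 1 x)"
      unfolding window_scale
      by (subst (2) lborel_integral_real_affine[where c = 2 and t = 0])
         (auto simp: scaleR_conv_of_real mult.left_commute[of _ "2::complex"])
    also have "complex_of_real (sqrt 2) * (?c * (LINT x|lborel. \<psi> (x / 2) * window \<tau> 1 x) / 2)
        = ?c * (LINT x|lborel. U \<psi> x * window \<tau> 1 x)"
    proof -
      \<comment> \<open>The \<open>sqrt 2\<close> of the defining relation and the
        \<open>1 / 2\<close> of the change of variables combine to the normalization of
        \<open>U\<close>.\<close>
      have "sqrt 2 / 2 = (2::real) powr (-1/2)"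
        by (simp add: powr_minus_divide powr_half_sqrt real_div_sqrt field_simps)
      then have eqU: "(LINT x|lborel. U \<psi> x * window \<tau> 1 x) = complex_of_real (sqrt 2 / 2) * (LINT x|lborel. \<psi> (x / 2) * window \<tau> 1 x)"
        unfolding U_def by (simp add: mult.assoc)
      show ?thesis unfolding eqU by simp
    qed
    finally have "(LINT x|lborel. g x * window \<tau> 1 x) = (LINT x|lborel. U \<psi> x * window \<tau> 1 x)"
      using gw by simp
    then show ?thesis
      using L2 window_L2[of 1 \<tau>] by (simp add: left_diff_distrib L2_mult_integrable U_L2)
  qed
  have "AE x in lborel. g x - U \<psi> x = 0"
    using L2 by (intro L2_fourier_window_zero win L2_diff U_L2)
  then show ?thesis by eventually_elim simp
qed

section \<open>Translation and dilation on the line\<close>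

text \<open>Puts \<open>U\<close> (\<open>q = 2\<close>) and the scaling on the left of the
  decomposition (\<open>q = N\<close>) into one commuting family of isometries.\<close>

definition dilate :: "real \<Rightarrow> (real \<Rightarrow> complex) \<Rightarrow> real \<Rightarrow> complex" where
  "dilate q f = (\<lambda>x. complex_of_real (q powr (-1/2)) * f (x / q))"

lemma U_eq_dilate: "U = dilate 2"
  by (simp add: fun_eq_iff U_def dilate_def)

lemma dilate_inner: "q > 0 \<Longrightarrow> L2_inner lborel (dilate q f) (dilate q g) = L2_inner lborel f g"
proof -
  assume q: "q > 0"
  have "q powr (-1/2) * q powr (-1/2) * q = 1"
  proof -
    have "q powr (-1/2) * q powr (-1/2) = q powr (-1)" by (subst powr_add[symmetric]) simp
    then show ?thesis using q by (simp add: powr_minus)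
  qed
  then have c: "complex_of_real (q powr (-1/2)) * complex_of_real (q powr (-1/2)) * of_real q = 1"
    by (metis of_real_1 of_real_mult)
  have "(\<lambda>x. dilate q f (q * x) * cnj (dilate q g (q * x)))
      = (\<lambda>x. complex_of_real (q powr (-1/2)) * complex_of_real (q powr (-1/2)) * (f x * cnj (g x)))"
    using q by (simp add: dilate_def mult_ac)
  then have "L2_inner lborel (dilate q f) (dilate q g)
      = q *\<^sub>R (LINT x|lborel. complex_of_real (q powr (-1/2)) * complex_of_real (q powr (-1/2)) * (f x * cnj (g x)))"
    using lborel_integral_real_affine[of q "\<lambda>x. dilate q f x * cnj (dilate q g x)" 0] q
    by (simp add: L2_inner_def)
  also have "\<dots> = (complex_of_real (q powr (-1/2)) * complex_of_real (q powr (-1/2)) * of_real q) * L2_inner lborel f g"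
    by (simp add: L2_inner_def scaleR_conv_of_real)
  finally show ?thesis by (simp only: c mult_1)
qed

lemma dilate_L2: "q > 0 \<Longrightarrow> f \<in> L2 lborel \<Longrightarrow> dilate q f \<in> L2 lborel"
  unfolding dilate_def using L2_cmult[OF L2_dilate[of f "1/q"]] by simp

lemma dilate_isometry:
  "q > 0 \<Longrightarrow> f \<in> L2 lborel \<Longrightarrow> dilate q f \<in> L2 lborel \<and> L2_norm lborel (dilate q f) = L2_norm lborel f"
  by (auto intro: dilate_L2 L2_norm_eqI simp: dilate_inner)

lemma dilate_diff: "dilate q (\<lambda>x. f x - g x) = (\<lambda>x. dilate q f x - dilate q g x)"
  by (simp add: dilate_def right_diff_distrib)

lemma translate_inner: "L2_inner lborel (translate f k) (translate g k) = L2_inner lborel f g"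
  unfolding L2_inner_def translate_def
  by (subst lborel_integral_real_affine[where c = 1 and t = "of_int k"]) auto

lemma translate_translate: "translate (translate f j) k = translate f (j + k)"
  by (simp add: translate_def algebra_simps)

lemma translate_0 [simp]: "translate f 0 = f"
  by (simp add: translate_def)

lemma translate_inner_shift: "L2_inner lborel (translate f j) (translate g k) = L2_inner lborel f (translate g (k - j))"
  using translate_inner[of f j "translate g (k - j)"] by (simp add: translate_translate)

lemma translate_isometry:
  "f \<in> L2 lborel \<Longrightarrow> translate f k \<in> L2 lborel \<and> L2_norm lborel (translate f k) = L2_norm lborel f"
  by (auto intro: translate_L2 L2_norm_eqI simp: translate_inner)

lemma dilate_translate: "q > 0 \<Longrightarrow> dilate (real q) (translate f k) = translate (dilate (real q) f) (int q * k)"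
  by (simp add: dilate_def translate_def field_simps)

lemma U_translate: "U (translate f k) = translate (U f) (2 * k)"
  using dilate_translate[of 2 f k] by (simp add: U_eq_dilate)

lemma U_inner: "L2_inner lborel (U f) (U g) = L2_inner lborel f g"
  by (simp add: U_eq_dilate dilate_inner)

lemma dilate_commute: "dilate p (dilate q f) = dilate q (dilate p f)"
  by (simp add: dilate_def mult_ac)

text \<open>The Fourier coefficients of \<open>C(z\<^sup>q) m(z)\<close> are computed by the same
  convolution as the inner products of the dilated series with the translates of \<open>\<phi>\<close>.\<close>

lemma dilate_series_coefficient:
  assumes q: "q > 0" and \<phi>: "\<phi> \<in> L2 lborel" and \<eta>: "\<eta> \<in> L2 lborel"
    and w: "L2_has_sum lborel (\<lambda>k x. c k * translate \<eta> k x) w"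
    and C: "is_fourier_series c C" and m: "m \<in> L2 circle"
    and coeff: "\<And>j. L2_inner lborel (dilate (real q) \<eta>) (translate \<phi> j) = L2_inner circle m (\<lambda>z. z powi j)"
  shows "L2_inner lborel (dilate (real q) w) (translate \<phi> n) = (LINT z|circle. C (z ^ q) * m z * cnj (z powi n))"
proof -
  have [measurable]: "m \<in> borel_measurable borel" using L2_measurable[OF m] by simp
  have Cs: "L2_has_sum circle (\<lambda>k z. c k * z powi k) C" using C by (simp add: is_fourier_series_def)
  have "L2_has_sum lborel (\<lambda>k. dilate q (\<lambda>x. c k * translate \<eta> k x)) (dilate q w)"
    by (rule L2_has_sum_isometry[where T = "dilate q", OF dilate_diff dilate_isometry w]) (use q in auto)
  then have "((\<lambda>k::int. L2_inner lborel (dilate q (\<lambda>x. c k * translate \<eta> k x)) (translate \<phi> n)) has_sum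
      L2_inner lborel (dilate q w) (translate \<phi> n)) UNIV"
    using q by (intro L2_has_sum_inner translate_L2 \<phi> dilate_L2 L2_cmult \<eta>) auto
  also have "(\<lambda>k::int. L2_inner lborel (dilate q (\<lambda>x. c k * translate \<eta> k x)) (translate \<phi> n))
      = (\<lambda>k::int. c k * L2_inner circle m (\<lambda>z. z powi (n - int q * k)))"
  proof
    fix k :: int
    have "dilate q (\<lambda>x. c k * translate \<eta> k x) = (\<lambda>x. c k * translate (dilate q \<eta>) (int q * k) x)"
      unfolding dilate_translate[OF q, symmetric] by (simp add: dilate_def mult_ac)
    then show "L2_inner lborel (dilate q (\<lambda>x. c k * translate \<eta> k x)) (translate \<phi> n)
        = c k * L2_inner circle m (\<lambda>z. z powi (n - int q * k))"
      by (simp add: L2_inner_cmult_left translate_inner_shift coeff)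
  qed
  finally have 1: "((\<lambda>k::int. c k * L2_inner circle m (\<lambda>z. z powi (n - int q * k))) has_sum
      L2_inner lborel (dilate q w) (translate \<phi> n)) UNIV" .
  \<comment> \<open>\<open>C (z ^ q) * m z\<close> is a product of two L2 functions, for which only
    integrability is at hand; with \<open>m\<close> moved into the second argument, the L2 series of
    \<open>C\<close> can be paired termwise.\<close>
  have h: "(\<lambda>z. z powi n * cnj (m z)) \<in> L2 circle" by (intro L2_circle_mult_powi L2_cnj m)
  have "L2_has_sum circle (\<lambda>k z. c k * (z ^ q) powi k) (\<lambda>z. C (z ^ q))"
    by (rule L2_has_sum_isometry[where T = "\<lambda>f z. f (z ^ q)", OF _ _ Cs]) (auto simp: L2_circle_power q)
  then have "((\<lambda>k. L2_inner circle (\<lambda>z. c k * (z ^ q) powi k) (\<lambda>z. z powi n * cnj (m z))) has_sum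
      L2_inner circle (\<lambda>z. C (z ^ q)) (\<lambda>z. z powi n * cnj (m z))) UNIV"
    by (intro L2_has_sum_inner h L2_cmult L2_circle_power q L2_circle_powi)
  also have "(\<lambda>k. L2_inner circle (\<lambda>z. c k * (z ^ q) powi k) (\<lambda>z. z powi n * cnj (m z)))
      = (\<lambda>k::int. c k * L2_inner circle m (\<lambda>z. z powi (n - int q * k)))"
  proof
    fix k :: int
    have "L2_inner circle (\<lambda>z. (z ^ q) powi k) (\<lambda>z. z powi n * cnj (m z)) = L2_inner circle m (\<lambda>z. z powi (n - int q * k))"
      unfolding L2_inner_def
    proof (rule integral_cong_AE)
      show "AE z in circle. (z ^ q) powi k * cnj (z powi n * cnj (m z)) = m z * cnj (z powi (n - int q * k))"
        using AE_circle
      proof eventually_elim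
        case (elim z)
        then have "z \<noteq> 0" by auto
        have "(z ^ q) powi k = z powi (int q * k)" by (simp add: power_int_mult)
        then show ?case
          unfolding complex_cnj_mult cnj_power_int_circle[OF elim]
          using \<open>z \<noteq> 0\<close> by (simp add: mult_ac flip: power_int_add)
      qed
    qed measurable
    then show "L2_inner circle (\<lambda>z. c k * (z ^ q) powi k) (\<lambda>z. z powi n * cnj (m z))
        = c k * L2_inner circle m (\<lambda>z. z powi (n - int q * k))"
      by (simp add: L2_inner_cmult_left)
  qed
  finally have "L2_inner lborel (dilate q w) (translate \<phi> n) = L2_inner circle (\<lambda>z. C (z ^ q)) (\<lambda>z. z powi n * cnj (m z))"
    using 1 has_sum_unique by blast
  then show ?thesis by (simp add: L2_inner_def mult_ac)
qed

section \<open>The two-scale relation\<close>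

text \<open>\<open>is_m0\<close> only asserts that coefficients exist; here one sequence
  \<open>h\<close> is fixed that serves both the refinement equation and the symbol.\<close>

locale refinable =
  fixes \<phi> :: "real \<Rightarrow> complex" and m0 :: "complex \<Rightarrow> complex" and h :: "int \<Rightarrow> complex"
  assumes \<phi>_L2: "\<phi> \<in> L2 lborel"
    and orthonormal: "\<And>j k. L2_inner lborel (translate \<phi> j) (translate \<phi> k) = (if j = k then 1 else 0)"
    and refinement: "L2_has_sum lborel (\<lambda>k x. h k * translate \<phi> k x) (U \<phi>)"
    and symbol: "is_fourier_series h m0"
begin

lemma m0_L2: "m0 \<in> L2 circle"
  using symbol by (simp add: is_fourier_series_def L2_has_sum_limit)

lemma m0_measurable [measurable]: "m0 \<in> borel_measurable borel"
  using L2_measurable[OF m0_L2] by simp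

lemma U_\<phi>_L2: "U \<phi> \<in> L2 lborel"
  using \<phi>_L2 by (rule U_L2)

lemma U_\<phi>_coefficient: "L2_inner lborel (U \<phi>) (translate \<phi> j) = L2_inner circle m0 (\<lambda>z. z powi j)"
  using orthonormal_coefficient[OF refinement translate_L2[OF \<phi>_L2] orthonormal]
    fourier_series_coefficient[OF symbol] by simp

text \<open>Translates of \<open>U \<phi>\<close> lie in the closed span of the translates of
  \<open>\<phi>\<close>, so they see \<open>f\<close> only through its coefficients, wherever
  \<open>f\<close> itself lies. It is applied with \<open>U \<phi>\<close>, \<open>U \<psi>\<close>
  and \<open>U \<xi>\<close> as \<open>f\<close>.\<close>

lemma inner_translate_U_\<phi>:
  assumes f: "f \<in> L2 lborel" and F: "F \<in> L2 circle"
    and coeff: "\<And>j. L2_inner lborel f (translate \<phi> j) = L2_inner circle F (\<lambda>z. z powi j)"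
  shows "L2_inner lborel (translate (U \<phi>) l) f = L2_inner circle (\<lambda>z. z powi l * m0 z) F"
proof -
  have [measurable]: "F \<in> borel_measurable borel" using L2_measurable[OF F] by simp
  have "L2_has_sum lborel (\<lambda>k. translate (\<lambda>x. h k * translate \<phi> k x) l) (translate (U \<phi>) l)"
    by (rule L2_has_sum_isometry[where T = "\<lambda>f. translate f l", OF _ translate_isometry refinement])
       (simp_all add: translate_def)
  then have "((\<lambda>k. L2_inner lborel (translate (\<lambda>x. h k * translate \<phi> k x) l) f) has_sum
      L2_inner lborel (translate (U \<phi>) l) f) UNIV"
    by (intro L2_has_sum_inner translate_L2 L2_cmult \<phi>_L2 f)
  also have "(\<lambda>k. L2_inner lborel (translate (\<lambda>x. h k * translate \<phi> k x) l) f)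
      = (\<lambda>k. h k * L2_inner circle (\<lambda>z. z powi (k + l)) F)"
  proof
    fix k
    have "translate (\<lambda>x. h k * translate \<phi> k x) l = (\<lambda>x. h k * translate \<phi> (k + l) x)"
      by (simp add: translate_def algebra_simps)
    moreover have "L2_inner lborel (translate \<phi> (k + l)) f = L2_inner circle (\<lambda>z. z powi (k + l)) F"
      using coeff[of "k + l"] by (metis L2_inner_cnj)
    ultimately show "L2_inner lborel (translate (\<lambda>x. h k * translate \<phi> k x) l) f
        = h k * L2_inner circle (\<lambda>z. z powi (k + l)) F"
      by (simp add: L2_inner_cmult_left)
  qed
  finally have 1: "((\<lambda>k. h k * L2_inner circle (\<lambda>z. z powi (k + l)) F) has_sum
      L2_inner lborel (translate (U \<phi>) l) f) UNIV" .
  have FL2: "(\<lambda>z. z powi (- l) * F z) \<in> L2 circle" by (intro L2_circle_mult_powi F)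
  have "((\<lambda>k. L2_inner circle (\<lambda>z. h k * z powi k) (\<lambda>z. z powi (- l) * F z)) has_sum
      L2_inner circle m0 (\<lambda>z. z powi (- l) * F z)) UNIV"
    using symbol unfolding is_fourier_series_def by (intro L2_has_sum_inner FL2 L2_cmult L2_circle_powi)
  also have "(\<lambda>k. L2_inner circle (\<lambda>z. h k * z powi k) (\<lambda>z. z powi (- l) * F z))
      = (\<lambda>k. h k * L2_inner circle (\<lambda>z. z powi (k + l)) F)"
  proof
    fix k
    have "L2_inner circle (\<lambda>z. z powi k) (\<lambda>z. z powi (- l) * F z) = L2_inner circle (\<lambda>z. z powi (k + l)) F"
      unfolding L2_inner_def
    proof (rule integral_cong_AE)
      show "AE z in circle. z powi k * cnj (z powi (- l) * F z) = z powi (k + l) * cnj (F z)"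
        using AE_circle
      proof eventually_elim
        case (elim z)
        then have "z \<noteq> 0" by auto
        then show ?case unfolding complex_cnj_mult cnj_power_int_circle[OF elim] by (simp add: power_int_add)
      qed
    qed measurable
    then show "L2_inner circle (\<lambda>z. h k * z powi k) (\<lambda>z. z powi (- l) * F z) = h k * L2_inner circle (\<lambda>z. z powi (k + l)) F"
      by (simp add: L2_inner_cmult_left)
  qed
  finally have "L2_inner lborel (translate (U \<phi>) l) f = L2_inner circle m0 (\<lambda>z. z powi (- l) * F z)"
    using 1 has_sum_unique by blast
  also have "\<dots> = L2_inner circle (\<lambda>z. z powi l * m0 z) F"
    unfolding L2_inner_def
  proof (rule integral_cong_AE)
    show "AE z in circle. m0 z * cnj (z powi (- l) * F z) = z powi l * m0 z * cnj (F z)"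
      using AE_circle by eventually_elim (simp add: cnj_power_int_circle del: complex_cnj_power_int)
  qed measurable
  finally show ?thesis .
qed

text \<open>Adding the reflection cancels the odd Fourier coefficients of \<open>|m0|^2\<close> and
  doubles the even ones. The moment of index \<open>2 * i\<close> is the inner product of
  \<open>U \<phi>\<close> translated by \<open>2 * i\<close> with \<open>U \<phi>\<close>; removing
  \<open>U\<close> leaves \<open>\<phi>\<close> translated by \<open>i\<close> against
  \<open>\<phi>\<close>, which vanishes unless \<open>i = 0\<close>.\<close>

lemma m0_quadrature: "AE z in circle. (cmod (m0 z))\<^sup>2 + (cmod (m0 (- z)))\<^sup>2 = 2"
proof -
  interpret prob_space circle by (rule prob_space_circle)
  let ?P = "\<lambda>z. m0 z * cnj (m0 z)"
  have P: "integrable circle ?P" by (rule L2_inner_integrable[OF m0_L2 m0_L2])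
  have P': "integrable circle (\<lambda>z. ?P (- z))" by (rule circle_integrable_reflect[OF P])
  have "AE z in circle. ?P z + ?P (- z) - 2 = 0"
  proof (rule circle_fourier_unique)
    show "integrable circle (\<lambda>z. ?P z + ?P (- z) - 2)" using P P' by simp
    fix k
    have i1: "integrable circle (\<lambda>z. ?P z * z powi k)"
    proof (rule Bochner_Integration.integrable_bound[OF P])
      show "AE z in circle. norm (?P z * z powi k) \<le> norm (?P z)"
        using AE_circle by eventually_elim (simp add: norm_mult norm_power_int)
    qed measurable
    have i2: "integrable circle (\<lambda>z. ?P (- z) * z powi k)"
    proof (rule Bochner_Integration.integrable_bound[OF P'])
      show "AE z in circle. norm (?P (- z) * z powi k) \<le> norm (?P (- z))"
        using AE_circle by eventually_elim (simp add: norm_mult norm_power_int)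
    qed measurable
    have i3: "integrable circle (\<lambda>z. z powi k)"
      using L2_inner_integrable[OF L2_circle_powi[of k] L2_circle_one] by simp
    have refl: "(LINT z|circle. ?P (- z) * z powi k) = (LINT z|circle. ?P z * (- z) powi k)"
      using circle_integral_reflect[of "\<lambda>z. ?P z * (- z) powi k"] by simp
    have "(LINT z|circle. (?P z + ?P (- z) - 2) * z powi k)
        = (LINT z|circle. ?P z * z powi k) + (LINT z|circle. ?P z * (- z) powi k) - 2 * (if k = 0 then 1 else 0)"
      unfolding refl[symmetric] using i1 i2 i3 by (simp add: left_diff_distrib distrib_right circle_moment)
    also have "\<dots> = 0"
    proof (cases "even k")
      case True
      then obtain i where k: "k = 2 * i" by blast
      have "(LINT z|circle. ?P z * z powi k) = L2_inner circle (\<lambda>z. z powi k * m0 z) m0"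
        by (simp add: L2_inner_def mult_ac)
      also have "\<dots> = L2_inner lborel (translate (U \<phi>) k) (U \<phi>)"
        by (rule inner_translate_U_\<phi>[OF U_\<phi>_L2 m0_L2 U_\<phi>_coefficient, symmetric])
      also have "\<dots> = L2_inner lborel (translate \<phi> i) (translate \<phi> 0)"
        by (simp add: k U_inner flip: U_translate)
      also have "\<dots> = (if k = 0 then 1 else 0)" unfolding orthonormal by (simp add: k)
      finally show ?thesis using True by (simp add: power_int_minus_left)
    next
      case False
      then show ?thesis by (auto simp: power_int_minus_left)
    qed
    finally show "(LINT z|circle. (?P z + ?P (- z) - 2) * z powi k) = 0" .
  qed
  then show ?thesis
  proof eventually_elim
    case (elim z)
    then have "complex_of_real ((cmod (m0 z))\<^sup>2 + (cmod (m0 (- z)))\<^sup>2) = 2"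
      by (simp add: complex_norm_square del: of_real_power)
    then show ?case by (metis of_real_eq_iff of_real_numeral)
  qed
qed

text \<open>It is this bound that lets \<open>S m0\<close> and \<open>S m1\<close> map L2 into
  itself.\<close>

lemma m0_bounded: "AE z in circle. cmod (m0 z) \<le> sqrt 2" "AE z in circle. cmod (m0 (- z)) \<le> sqrt 2"
  using m0_quadrature
  by (auto elim!: eventually_mono intro!: real_le_rsqrt) (metis le_add_same_cancel1 le_add_same_cancel2 zero_le_power2)+

definition m1 :: "complex \<Rightarrow> complex" where
  "m1 = (\<lambda>z. z * cnj (m0 (- z)))"

lemma m1_measurable [measurable]: "m1 \<in> borel_measurable borel"
  unfolding m1_def by measurable

lemma cmod_m1: "AE z in circle. cmod (m1 z) = cmod (m0 (- z))"
  using AE_circle by eventually_elim (simp add: m1_def norm_mult)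

lemma m1_bounded: "AE z in circle. cmod (m1 z) \<le> sqrt 2"
  using cmod_m1 m0_bounded(2) by eventually_elim simp

lemma m1_L2: "m1 \<in> L2 circle"
  using L2_circle_bounded_mult[OF L2_circle_one _ m1_bounded] by simp

section \<open>The mother function and its translates\<close>

context
  fixes \<psi> :: "real \<Rightarrow> complex"
  assumes mother: "is_mother_function \<phi> m1 \<psi>"
begin

lemma \<psi>_L2: "\<psi> \<in> L2 lborel"
  using mother by (auto simp: is_mother_function_def is_fourier_def)

text \<open>On the circle, \<open>m\<^sub>1(z) = \<Sum> (-1)\<^sup>k cnj(h\<^sub>k) z\<^sup>1\<^sup>-\<^sup>k\<close>; the same coefficients
  give a series in translates of \<open>\<phi>\<close>, and it is equal to \<open>U \<psi>\<close> because the
  Fourier transforms agree.\<close>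

lemma U_\<psi>_coefficient: "L2_inner lborel (U \<psi>) (translate \<phi> j) = L2_inner circle m1 (\<lambda>z. z powi j)"
proof -
  define d where "d k = cnj (h k * (-1) powi k)" for k
  let ?K = "\<lambda>n. {- int n..int n}"
  \<comment> \<open>Takes \<open>m0\<close> to \<open>m1\<close>; as it preserves the norm and
    differences, it can be applied to the Fourier series of \<open>m0\<close> term by term.\<close>
  let ?T = "\<lambda>(f::complex \<Rightarrow> complex) z. z * cnj (f (- z))"
  have T: "?T f \<in> L2 circle \<and> L2_norm circle (?T f) = L2_norm circle f" if f: "f \<in> L2 circle" for f
  proof -
    have [measurable]: "f \<in> borel_measurable borel" using L2_measurable[OF f] by simp
    have eq: "AE z in circle. (cmod (?T f z))\<^sup>2 = (cmod (f (- z)))\<^sup>2"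
      using AE_circle by eventually_elim (simp add: norm_mult)
    have "integrable circle (\<lambda>z. (cmod (f (- z)))\<^sup>2)"
      by (rule circle_integrable_reflect[OF L2_integrable_sq[OF f]])
    then have "integrable circle (\<lambda>z. (cmod (?T f z))\<^sup>2)"
      using eq by (subst integrable_cong_AE[of _ _ "\<lambda>z. (cmod (f (- z)))\<^sup>2"]) auto
    moreover have "(LINT z|circle. (cmod (?T f z))\<^sup>2) = (LINT z|circle. (cmod (f z))\<^sup>2)"
    proof -
      have "(LINT z|circle. (cmod (?T f z))\<^sup>2) = (LINT z|circle. (cmod (f (- z)))\<^sup>2)"
        by (rule integral_cong_AE) (use eq in auto)
      also have "\<dots> = (LINT z|circle. (cmod (f z))\<^sup>2)"
        by (rule circle_integral_reflect) measurable
      finally show ?thesis .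
    qed
    ultimately show ?thesis by (simp add: L2_def L2_norm_def)
  qed
  have "L2_has_sum circle (\<lambda>k. ?T (\<lambda>z. h k * z powi k)) (?T m0)"
    by (rule L2_has_sum_isometry[of ?T, OF _ T symbol[unfolded is_fourier_series_def]])
       (simp add: right_diff_distrib)
  from L2_has_sum_sequentially[OF this]
  have lim_m1: "L2_tendsto circle (\<lambda>n z. \<Sum>k\<in>?K n. d k * z powi (1 - k)) m1 sequentially"
    unfolding m1_def
  proof (rule L2_tendsto_AE_cong)
    show "AE z in circle. (\<Sum>k\<in>?K n. ?T (\<lambda>z. h k * z powi k) z) = (\<Sum>k\<in>?K n. d k * z powi (1 - k))" for n
      using AE_circle
    proof eventually_elim
      case (elim z)
      then have z: "z \<noteq> 0" by auto
      have "?T (\<lambda>z. h k * z powi k) z = d k * z powi (1 - k)" for k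
      proof -
        have "(- z) powi k = (-1) powi k * z powi k"
          using power_int_mult_distrib[of "-1" z k] by simp
        then have "?T (\<lambda>z. h k * z powi k) z = d k * (z powi 1 * cnj (z powi k))"
          by (simp add: d_def)
        also have "z powi 1 * cnj (z powi k) = z powi (1 - k)"
          unfolding cnj_power_int_circle[OF elim] using z by (simp add: power_int_diff power_int_minus field_simps)
        finally show ?thesis .
      qed
      then show ?case by simp
    qed
  qed measurable
  \<comment> \<open>Parseval: pairing the refinement series with \<open>U \<phi>\<close> itself
    produces the sum of \<open>|h k|^2\<close>.\<close>
  have "(\<lambda>k. complex_of_real ((cmod (h k))\<^sup>2)) summable_on UNIV"
  proof -
    have "((\<lambda>k. L2_inner lborel (\<lambda>x. h k * translate \<phi> k x) (U \<phi>)) has_sum L2_inner lborel (U \<phi>) (U \<phi>)) UNIV"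
      by (intro L2_has_sum_inner refinement L2_cmult translate_L2 \<phi>_L2 U_\<phi>_L2)
    moreover have "L2_inner lborel (\<lambda>x. h k * translate \<phi> k x) (U \<phi>) = complex_of_real ((cmod (h k))\<^sup>2)" for k
    proof -
      have "L2_inner lborel (translate \<phi> k) (U \<phi>) = cnj (h k)"
        using orthonormal_coefficient[OF refinement translate_L2[OF \<phi>_L2] orthonormal, of k]
        by (metis L2_inner_cnj)
      then show ?thesis by (simp only: L2_inner_cmult_left complex_norm_square)
    qed
    ultimately show ?thesis by (auto simp: summable_on_def)
  qed
  then have "(\<lambda>k. (cmod (h k))\<^sup>2) summable_on UNIV"
    using summable_on_Re by fastforce
  then have "(\<lambda>k. (cmod (d k))\<^sup>2) summable_on UNIV"
    by (simp add: d_def norm_mult norm_power_int)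
  \<comment> \<open>The series gets a limit before anything relates it to \<open>\<psi>\<close>; the
    comparison of transforms then identifies \<open>g\<close>.\<close>
  then obtain g where lim_g: "L2_tendsto lborel (\<lambda>n x. \<Sum>k\<in>?K n. d k * translate \<phi> (1 - k) x) g sequentially"
    by (rule L2_orthonormal_series[of "\<lambda>k. translate \<phi> (1 - k)" lborel, rotated 2])
       (auto simp: orthonormal intro: translate_L2 \<phi>_L2)
  from mother obtain \<phi>h \<psi>h where "is_fourier \<phi> \<phi>h" "is_fourier \<psi> \<psi>h"
    "AE t in lborel. complex_of_real (sqrt 2) * \<psi>h (2 * t) = periodic m1 t * \<phi>h t"
    by (auto simp: is_mother_function_def)
  from fourier_symbol_expansion[OF this lim_g lim_m1] have g: "AE x in lborel. g x = U \<psi> x" .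
  have "L2_inner lborel (\<lambda>x. \<Sum>k\<in>?K n. d k * translate \<phi> (1 - k) x) (translate \<phi> j)
      = L2_inner circle (\<lambda>z. \<Sum>k\<in>?K n. d k * z powi (1 - k)) (\<lambda>z. z powi j)" for n
    by (simp add: L2_inner_sum_left L2_inner_cmult_left L2_cmult translate_L2 \<phi>_L2 L2_circle_powi
        orthonormal circle_powi_orthonormal)
  then have "L2_inner lborel g (translate \<phi> j) = L2_inner circle m1 (\<lambda>z. z powi j)"
    using L2_tendsto_inner[OF lim_g translate_L2[OF \<phi>_L2, of j]] L2_tendsto_inner[OF lim_m1 L2_circle_powi[of j]]
    by (intro LIMSEQ_unique) simp_all
  moreover have "L2_inner lborel g (translate \<phi> j) = L2_inner lborel (U \<psi>) (translate \<phi> j)"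
    using lim_g by (intro L2_inner_AE_cong g L2_measurable)
      (auto simp: L2_tendsto_def intro: U_L2 \<psi>_L2 translate_L2 \<phi>_L2)
  ultimately show ?thesis by simp
qed

text \<open>After applying \<open>U\<close>, the inner product becomes an integral over the circle.
  Since \<open>U\<close> doubles translations, the exponent of \<open>z\<close> is even, while
  \<open>m0 z * cnj (m1 z) = cnj z * m0 z * m0 (- z)\<close> is odd.\<close>

lemma translates_orthogonal: "L2_inner lborel (translate \<psi> k) (translate \<phi> j) = 0"
proof -
  let ?l = "2 * (j - k)"
  let ?Q = "\<lambda>z. z powi ?l * m0 z * cnj (m1 z)"
  have "L2_inner lborel (translate \<phi> j) (translate \<psi> k) = L2_inner lborel (translate (U \<phi>) (2 * j)) (translate (U \<psi>) (2 * k))"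
    by (metis U_inner U_translate)
  also have "\<dots> = L2_inner lborel (translate (U \<phi>) ?l) (U \<psi>)"
    using translate_inner[of "translate (U \<phi>) ?l" "2 * k" "U \<psi>"] by (simp add: translate_translate)
  also have "\<dots> = (LINT z|circle. ?Q z)"
    using inner_translate_U_\<phi>[OF U_L2[OF \<psi>_L2] m1_L2 U_\<psi>_coefficient, of ?l] by (simp only: L2_inner_def)
  also have "\<dots> = 0"
    by (rule circle_integral_odd) (auto simp: m1_def power_int_minus_left mult_ac)
  finally show ?thesis by (metis L2_inner_cnj complex_cnj_zero)
qed

end

section \<open>The isometries \<open>S m0\<close> and \<open>S m1\<close>\<close>

lemma S_m0_L2: "A \<in> L2 circle \<Longrightarrow> S m0 A \<in> L2 circle"
  unfolding S_def by (rule L2_circle_bounded_mult[OF L2_circle_power(1) _ m0_bounded(1)]) auto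

lemma S_m1_L2: "A \<in> L2 circle \<Longrightarrow> S m1 A \<in> L2 circle"
  unfolding S_def by (rule L2_circle_bounded_mult[OF L2_circle_power(1) _ m1_bounded]) auto

lemma S_orthogonal:
  assumes "A \<in> L2 circle" "B \<in> L2 circle"
  shows "L2_inner circle (S m0 A) (S m1 B) = 0"
  using L2_measurable[OF assms(1)] L2_measurable[OF assms(2)]
  unfolding L2_inner_def S_def by (intro circle_integral_odd) (auto simp: m1_def mult_ac)

text \<open>Averaging over \<open>z\<close> and \<open>- z\<close> leaves
  \<open>A (z\<^sup>2)\<close> alone and, by the quadrature identity, replaces \<open>|m0|^2\<close>
  by 1; the square map then preserves Haar measure.\<close>

lemma S_m0_norm:
  assumes A: "A \<in> L2 circle"
  shows "L2_norm circle (S m0 A) = L2_norm circle A"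
proof -
  have [measurable]: "A \<in> borel_measurable borel" using L2_measurable[OF A] by simp
  let ?F = "\<lambda>z. (cmod (m0 z))\<^sup>2 * (cmod (A (z\<^sup>2)))\<^sup>2"
  have F: "integrable circle ?F"
    using L2_integrable_sq[OF S_m0_L2[OF A]] by (simp add: S_def norm_mult power_mult_distrib)
  have F': "integrable circle (\<lambda>z. ?F (- z))" by (rule circle_integrable_reflect[OF F])
  have "2 * (LINT z|circle. ?F z) = (LINT z|circle. ?F z) + (LINT z|circle. ?F (- z))"
    by (subst circle_integral_reflect) auto
  also have "\<dots> = (LINT z|circle. ?F z + ?F (- z))"
    using F F' by simp
  also have "\<dots> = (LINT z|circle. 2 * (cmod (A (z\<^sup>2)))\<^sup>2)"
  proof (rule integral_cong_AE)
    show "AE z in circle. ?F z + ?F (- z) = 2 * (cmod (A (z\<^sup>2)))\<^sup>2"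
      using m0_quadrature by eventually_elim (simp flip: distrib_right)
  qed measurable
  also have "\<dots> = 2 * (L2_norm circle A)\<^sup>2"
    using circle_integral_power[of "\<lambda>z. (cmod (A z))\<^sup>2" 2] by (simp add: L2_norm_sq)
  finally have "(L2_norm circle (S m0 A))\<^sup>2 = (L2_norm circle A)\<^sup>2"
    by (simp add: L2_norm_sq S_def norm_mult power_mult_distrib)
  then show ?thesis by (rule power2_eq_imp_eq) simp_all
qed

text \<open>On the circle \<open>|m1 z| = |m0 (- z)|\<close>, and \<open>z\<^sup>2\<close> is even,
  so a reflection carries the integrand to that of \<open>S m0 A\<close>.\<close>

lemma S_m1_norm:
  assumes A: "A \<in> L2 circle"
  shows "L2_norm circle (S m1 A) = L2_norm circle A"
proof -
  have [measurable]: "A \<in> borel_measurable borel" using L2_measurable[OF A] by simp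
  have "(LINT z|circle. (cmod (S m1 A z))\<^sup>2) = (LINT z|circle. (cmod (S m0 A (- z)))\<^sup>2)"
  proof (rule integral_cong_AE)
    show "AE z in circle. (cmod (S m1 A z))\<^sup>2 = (cmod (S m0 A (- z)))\<^sup>2"
      using cmod_m1 by eventually_elim (simp add: S_def norm_mult)
  qed (auto simp: S_def)
  also have "\<dots> = (LINT z|circle. (cmod (S m0 A z))\<^sup>2)"
    by (rule circle_integral_reflect) (simp add: S_def)
  finally show ?thesis
    using S_m0_norm[OF A] by (simp add: L2_norm_def)
qed

end

section \<open>The decomposition of the dilated father function\<close>

lemma orth_V_imp_U_orth_translate:
  assumes \<phi>: "\<phi> \<in> L2 lborel" and \<xi>: "\<xi> \<in> L2_orth lborel (V \<phi> (-1))"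
  shows "L2_inner lborel (U \<xi>) (translate \<phi> n) = 0"
proof -
  \<comment> \<open>Surjectivity gives \<open>U (inv U f) = f\<close>; since \<open>U\<close>
    preserves inner products, orthogonality of \<open>\<xi>\<close> to \<open>inv U f\<close>
    becomes orthogonality of \<open>U \<xi>\<close> to \<open>f\<close>.\<close>
  have "surj U"
  proof (rule surjI)
    fix f :: "real \<Rightarrow> complex"
    show "U (\<lambda>x. f (2 * x) / complex_of_real (2 powr (-1/2))) = f"
      by (simp add: U_def)
  qed
  then have U: "U (inv U (translate \<phi> n)) = translate \<phi> n" by (rule surj_f_inv_f)
  have "translate \<phi> n \<in> L2_closure lborel (complex_span (range (translate \<phi>)))"
  proof -
    have "translate \<phi> n \<in> complex_span (range (translate \<phi>))"
      unfolding complex_span_def by (intro CollectI exI[of _ "{translate \<phi> n}"] exI[of _ "\<lambda>_. 1"]) auto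
    then show ?thesis
      using translate_L2[OF \<phi>, of n] unfolding L2_closure_def
      by (auto intro!: bexI[of _ "translate \<phi> n"] simp: L2_norm_def)
  qed
  then have "inv U (translate \<phi> n) \<in> V \<phi> (-1)"
    by (auto simp: V_def U_pow_def)
  then have "L2_inner lborel \<xi> (inv U (translate \<phi> n)) = 0"
    using \<xi> by (simp add: L2_orth_def)
  then show ?thesis
    using dilate_inner[of 2 \<xi> "inv U (translate \<phi> n)"] U by (simp add: U_eq_dilate)
qed

theorem proposition11p2:
  fixes N :: nat
    and \<phi> \<psi> \<xi> u v :: "real \<Rightarrow> complex"
    and m0 m1 A B :: "complex \<Rightarrow> complex"
    and a b :: "int \<Rightarrow> complex"
  assumes "N \<ge> 2"
    and "father_function \<phi>"
    and "is_m0 \<phi> m0"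
    and "m1 = (\<lambda>z. z * cnj (m0 (- z)))"
    and "is_mother_function \<phi> m1 \<psi>"
    and "L2_has_sum lborel (\<lambda>k x. a k * translate \<phi> k x) u"
    and "L2_has_sum lborel (\<lambda>k x. b k * translate \<psi> k x) v"
    and "AE x in lborel.
           complex_of_real (real N powr (-1/2)) * \<phi> (x / real N) = u x + v x + \<xi> x"
    and "\<xi> \<in> L2_orth lborel (V \<phi> (-1))"
    and "(\<lambda>k. (cmod (a k))\<^sup>2 + (cmod (b k))\<^sup>2) summable_on UNIV"
    and "(\<Sum>\<^sub>\<infinity>k. (cmod (a k))\<^sup>2 + (cmod (b k))\<^sup>2) + (L2_norm lborel \<xi>)\<^sup>2 = 1"
    and "is_fourier_series a A"
    and "is_fourier_series b B"
  shows "(AE t in lborel.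
            periodic A (2 * t) * periodic m0 t + periodic B (2 * t) * periodic m1 t
              = periodic A t * periodic m0 (real N * t)) \<and>
         (AE z in circle. S m0 A z + S m1 B z = m0 (z ^ N) * A z) \<and>
         S m0 A \<in> L2 circle \<and> S m1 B \<in> L2 circle \<and>
         L2_inner circle (S m0 A) (S m1 B) = 0 \<and>
         (L2_norm circle A)\<^sup>2 + (L2_norm circle B)\<^sup>2
           = (LINT z|circle. (cmod (m0 (z ^ N) * A z))\<^sup>2) \<and>
         (LINT z|circle. (cmod (m0 (z ^ N) * A z))\<^sup>2)
           = (1 / real N) *
             (LINT z|circle. (cmod (m0 z))\<^sup>2 * (\<Sum>w | w ^ N = z. (cmod (A w))\<^sup>2))"
proof -
  from \<open>is_m0 \<phi> m0\<close> obtain h where h: "L2_has_sum lborel (\<lambda>k x. h k * translate \<phi> k x) (U \<phi>)" "is_fourier_series h m0"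
    by (auto simp: is_m0_def)
  interpret refinable \<phi> m0 h
    using \<open>father_function \<phi>\<close> h by unfold_locales (auto simp: father_function_def)
  have m1: "m1 = refinable.m1 m0"
    unfolding assms(4) refinable.m1_def[OF refinable_axioms] ..
  have mother: "is_mother_function \<phi> (refinable.m1 m0) \<psi>" using assms(5) by (simp only: m1)
  note \<psi> = \<psi>_L2[OF mother] and u = assms(6) and v = assms(7) and A = assms(12) and B = assms(13)
  have N: "N > 0" using \<open>N \<ge> 2\<close> by simp
  have L2: "A \<in> L2 circle" "B \<in> L2 circle" "u \<in> L2 lborel" "v \<in> L2 lborel" "\<xi> \<in> L2 lborel"
    using A B u v assms(9) by (auto simp: is_fourier_series_def L2_orth_def intro: L2_has_sum_limit)
  have [measurable]: "A \<in> borel_measurable borel" "B \<in> borel_measurable borel"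
    using L2[THEN L2_measurable] by auto
  have U\<xi>: "L2_inner lborel (U \<xi>) (translate \<phi> n) = 0" for n
    by (rule orth_V_imp_U_orth_translate[OF \<phi>_L2 assms(9)])
  \<comment> \<open>Uses that \<open>V \<phi> 0\<close> is contained in
    \<open>V \<phi> (-1)\<close>, in the form of the refinement equation:
    \<open>U (translate \<phi> j)\<close> is a translate of \<open>U \<phi>\<close>, and the symbol
    of \<open>U \<xi>\<close> is zero.\<close>
  have \<xi>\<phi>: "L2_inner lborel \<xi> (translate \<phi> j) = 0" for j
  proof -
    have "L2_inner lborel (translate (U \<phi>) (2 * j)) (U \<xi>) = L2_inner circle (\<lambda>z. z powi (2 * j) * m0 z) (\<lambda>z. 0)"
      by (rule inner_translate_U_\<phi>[OF U_L2[OF L2(5)] L2_zero]) (simp add: U\<xi>, simp add: L2_inner_def)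
    then have "L2_inner lborel (U (translate \<phi> j)) (U \<xi>) = 0"
      unfolding U_translate by (simp add: L2_inner_def)
    then show ?thesis unfolding U_inner by (metis L2_inner_cnj complex_cnj_zero)
  qed
  have v\<phi>: "L2_inner lborel v (translate \<phi> j) = 0" for j
  proof -
    have "((\<lambda>k. L2_inner lborel (\<lambda>x. b k * translate \<psi> k x) (translate \<phi> j)) has_sum L2_inner lborel v (translate \<phi> j)) UNIV"
      by (intro L2_has_sum_inner v L2_cmult translate_L2 \<psi> \<phi>_L2)
    then have "((\<lambda>k::int. 0) has_sum L2_inner lborel v (translate \<phi> j)) UNIV"
      by (simp add: L2_inner_cmult_left translates_orthogonal[OF mother])
    then show ?thesis by (rule has_sum_unique) (simp add: has_sum_0)
  qed
  let ?f = "dilate (real N) \<phi>" and ?s = "\<lambda>x. u x + v x + \<xi> x"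
  have f_L2: "?f \<in> L2 lborel" and s_L2: "?s \<in> L2 lborel"
    using N by (auto intro!: dilate_L2 L2_add L2 \<phi>_L2)
  have f: "AE x in lborel. ?f x = ?s x" using assms(8) by (simp add: dilate_def)
  \<comment> \<open>\<open>A\<close> becomes the symbol of the \<open>N\<close>-dilate of
    \<open>\<phi>\<close> in the sense in which \<open>m0\<close> is the symbol of
    \<open>U \<phi>\<close>.\<close>
  have f_coeff: "L2_inner lborel ?f (translate \<phi> j) = L2_inner circle A (\<lambda>z. z powi j)" for j
  proof -
    have "L2_inner lborel ?f (translate \<phi> j) = L2_inner lborel ?s (translate \<phi> j)"
      by (intro L2_inner_AE_cong L2_measurable f_L2 s_L2 translate_L2 \<phi>_L2 f)
    also have "\<dots> = L2_inner lborel u (translate \<phi> j)"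
      using L2 translate_L2[OF \<phi>_L2] by (simp add: L2_inner_add_left L2_add v\<phi> \<xi>\<phi>)
    also have "\<dots> = a j"
      by (rule orthonormal_coefficient[OF u translate_L2[OF \<phi>_L2] orthonormal])
    finally show ?thesis by (simp add: fourier_series_coefficient[OF A])
  qed
  define D where "D z = S m0 A z + S m1 B z - m0 (z ^ N) * A z" for z
  have prod: "integrable circle (\<lambda>z. F (z ^ q) * G z * cnj (z powi n))"
    if "F \<in> L2 circle" "G \<in> L2 circle" "q > 0" for F G q n
    using L2_inner_integrable[OF L2_circle_power(1)[OF that(1,3)] L2_circle_mult_powi[OF L2_cnj[OF that(2)], of n]]
    by (simp add: mult_ac)
  have D_coeff: "(LINT z|circle. D z * cnj (z powi n)) = 0" for n
  proof -
    have U_f: "L2_inner lborel (U ?f) (translate \<phi> n) = L2_inner lborel (U u) (translate \<phi> n) + L2_inner lborel (U v) (translate \<phi> n)"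
    proof -
      have "AE x in lborel. U ?f x = U ?s x"
      proof -
        have "AE x in lborel. ?f (0 + (1/2) * x) = ?s (0 + (1/2) * x)"
          using f f_L2 s_L2 by (intro AE_borel_affine) (auto dest!: L2_measurable)
        then show ?thesis by (simp add: U_def)
      qed
      then have "L2_inner lborel (U ?f) (translate \<phi> n) = L2_inner lborel (U ?s) (translate \<phi> n)"
        by (intro L2_inner_AE_cong L2_measurable U_L2 f_L2 s_L2 translate_L2 \<phi>_L2)
      also have "U ?s = (\<lambda>x. U u x + U v x + U \<xi> x)"
        by (simp add: U_def algebra_simps)
      also have "L2_inner lborel \<dots> (translate \<phi> n) = L2_inner lborel (U u) (translate \<phi> n) + L2_inner lborel (U v) (translate \<phi> n)"
        using L2 by (simp add: L2_inner_add_left L2_add U_L2 translate_L2 \<phi>_L2 U\<xi>)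
      finally show ?thesis .
    qed
    have "L2_inner lborel (U u) (translate \<phi> n) = (LINT z|circle. A (z\<^sup>2) * m0 z * cnj (z powi n))"
      using dilate_series_coefficient[of 2, OF _ \<phi>_L2 \<phi>_L2 u A m0_L2] U_\<phi>_coefficient
      by (simp add: U_eq_dilate)
    moreover have "L2_inner lborel (U v) (translate \<phi> n) = (LINT z|circle. B (z\<^sup>2) * m1 z * cnj (z powi n))"
      using dilate_series_coefficient[of 2, OF _ \<phi>_L2 \<psi> v B m1_L2] U_\<psi>_coefficient[OF mother]
      by (simp add: U_eq_dilate m1)
    \<comment> \<open>After the dilations by 2 and \<open>N\<close> are exchanged, \<open>h\<close>
      and \<open>m0\<close> supply the series and \<open>A\<close> the symbol, the reverse of the
      expansion of \<open>U u\<close>.\<close>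
    moreover have "L2_inner lborel (U ?f) (translate \<phi> n) = (LINT z|circle. m0 (z ^ N) * A z * cnj (z powi n))"
      using dilate_series_coefficient[OF N \<phi>_L2 \<phi>_L2 h L2(1) f_coeff, of n]
      by (simp add: U_eq_dilate dilate_commute)
    moreover have "(LINT z|circle. D z * cnj (z powi n))
        = (LINT z|circle. A (z\<^sup>2) * m0 z * cnj (z powi n)) + (LINT z|circle. B (z\<^sup>2) * m1 z * cnj (z powi n))
          - (LINT z|circle. m0 (z ^ N) * A z * cnj (z powi n))"
    proof -
      have "(LINT z|circle. D z * cnj (z powi n))
          = (LINT z|circle. A (z\<^sup>2) * m0 z * cnj (z powi n) + B (z\<^sup>2) * m1 z * cnj (z powi n) - m0 (z ^ N) * A z * cnj (z powi n))"
        by (intro Bochner_Integration.integral_cong) (simp_all add: D_def S_def algebra_simps)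
      then show ?thesis
        using prod[OF L2(1) m0_L2, of 2 n] prod[OF L2(2) m1_L2, of 2 n] prod[OF m0_L2 L2(1) N, of n]
        by (simp add: m1)
    qed
    ultimately show ?thesis using U_f by simp
  qed
  have "AE z in circle. D z = 0"
  proof (rule circle_fourier_unique)
    show "integrable circle D"
      using prod[OF L2(1) m0_L2, of 2 0] prod[OF L2(2) m1_L2, of 2 0] prod[OF m0_L2 L2(1) N, of 0]
      unfolding D_def S_def m1 by (simp add: mult.commute)
    then have [measurable]: "D \<in> borel_measurable borel" using borel_measurable_integrable by force
    fix k
    have "(LINT z|circle. D z * z powi k) = (LINT z|circle. D z * cnj (z powi (- k)))"
      by (rule integral_cong_AE)
        (use AE_circle in \<open>auto elim!: eventually_mono simp: cnj_power_int_circle simp del: complex_cnj_power_int\<close>)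
    then show "(LINT z|circle. D z * z powi k) = 0" by (simp only: D_coeff)
  qed
  then have eq: "AE z in circle. S m0 A z + S m1 B z = m0 (z ^ N) * A z"
    by eventually_elim (simp add: D_def)
  have eq_line: "AE t in lborel. periodic A (2 * t) * periodic m0 t + periodic B (2 * t) * periodic m1 t
      = periodic A t * periodic m0 (real N * t)"
  proof -
    have "exp (- \<i> * of_real (real q * t)) = exp (- \<i> * of_real t) ^ q" for q t
      by (simp add: exp_of_nat_mult[symmetric] mult_ac)
    from this[of 2] this[of N] AE_circle_imp_AE_periodic[OF eq] show ?thesis
      by (simp add: periodic_def S_def mult.commute)
  qed
  have S: "S m0 A \<in> L2 circle" "S m1 B \<in> L2 circle" "L2_inner circle (S m0 A) (S m1 B) = 0"
    using S_m0_L2 S_m1_L2 S_orthogonal L2 by (auto simp: m1)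
  \<comment> \<open>Square-integrability is inherited from the left-hand side through
    \<open>eq\<close>.\<close>
  have right_L2: "(\<lambda>z. m0 (z ^ N) * A z) \<in> L2 circle"
    by (rule L2_AE_cong[OF L2_add[OF S(1,2)] _ eq]) simp
  have norms: "(L2_norm circle A)\<^sup>2 + (L2_norm circle B)\<^sup>2 = (LINT z|circle. (cmod (m0 (z ^ N) * A z))\<^sup>2)"
  proof -
    have "(L2_norm circle A)\<^sup>2 + (L2_norm circle B)\<^sup>2 = (L2_norm circle (\<lambda>z. S m0 A z + S m1 B z))\<^sup>2"
      using L2_norm_Pythagoras[OF S] S_m0_norm[OF L2(1)] S_m1_norm[OF L2(2)] by (simp add: m1)
    also have "\<dots> = (LINT z|circle. (cmod (m0 (z ^ N) * A z))\<^sup>2)"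
      unfolding L2_norm_sq
      by (rule integral_cong_AE)
        (use eq L2_measurable[OF S(1)] L2_measurable[OF S(2)] in \<open>auto elim!: eventually_mono\<close>)
    finally show ?thesis .
  qed
  have roots: "(LINT z|circle. (cmod (m0 (z ^ N) * A z))\<^sup>2)
      = (1 / real N) * (LINT z|circle. (cmod (m0 z))\<^sup>2 * (\<Sum>w | w ^ N = z. (cmod (A w))\<^sup>2))"
  proof -
    \<comment> \<open>Over the roots \<open>w\<close> of \<open>z\<close>, the factor
      \<open>m0 (w ^ N)\<close> is the constant \<open>m0 z\<close> and leaves the sum; the factor
      \<open>N\<close> is the number of roots.\<close>
    have "(LINT z|circle. (\<Sum>w | w ^ N = z. (cmod (m0 (w ^ N) * A w))\<^sup>2)) = N * (LINT z|circle. (cmod (m0 (z ^ N) * A z))\<^sup>2)"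
      by (rule circle_integral_sum_roots[OF L2_integrable_sq[OF right_L2] N])
    moreover have "(\<Sum>w | w ^ N = z. (cmod (m0 (w ^ N) * A w))\<^sup>2) = (cmod (m0 z))\<^sup>2 * (\<Sum>w | w ^ N = z. (cmod (A w))\<^sup>2)" for z
      unfolding sum_distrib_left by (rule sum.cong) (auto simp: norm_mult power_mult_distrib)
    ultimately show ?thesis using N by simp
  qed
  show ?thesis using eq_line eq S norms roots by blast
qed

end
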